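(* Let $d\ge 3$ and let $X\sim f(\|x-\theta\|^2)$, $x,\theta\in\mathbb{R}^d$, be a scale mixture of normals, i.e. $X\mid V\sim N_d(\theta,V I_d)$ with a positive mixing variable $V$. Consider estimating $\theta$ under the loss $$L_{\omega,\ell}(\theta,\delta)=\ell\left(\omega\,\|\delta-X\|^2+(1-\omega)\,\|\delta-\theta\|^2\right),\qquad 0\le\omega<1,$$ where $\ell(\cdot)\ge 0$, $\ell'(\cdot)>0$, and $\ell'$ is completely monotone on $\mathbb{R}_+$. Consider the Baranchik-type estimator $$\delta_{a(1-\omega),r(\cdot)}(X)=\left(1-\frac{a(1-\omega)\,r(\|X\|^2)}{\|X\|^2}\right)X,$$ where $r(\cdot)$ satisfies $0\le r(\cdot)\le 1$, $r(\cdot)$ not identically $0$, $r'(\cdot)\ge 0$, and $\frac{d}{dt}\left(\frac{r(t)}{t}\right)\le 0$. Assume that $f_0^*(x)=\ell'((1-\omega)\|x\|^2)\,f(\|x\|^2)/K_1$ is a density on $\mathbb{R}^d$ (with $K_1$ the normalizing constant), and let $\mathbb{E}_{0,\omega}^{*}$ denote expectation when $X$ has density $f_0^*$. Then $\delta_{a(1-\omega),r(\cdot)}(X)$ dominates $X$ provided $$0<a<\frac{2}{\mathbb{E}_{0,\omega}^{*}\left(\frac{1}{\|X\|^2}\right)}$$ and provided $\mathbb{E}_{0,\omega}^{*}[\|X\|^2]$ and $\mathbb{E}_{0,\omega}^{*}[1/\|X\|^2]$ are finite.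
   Context: The notation $X\sim f(\|x-\theta\|^2)$ means that $X$ has Lebesgue density $x\mapsto f(\|x-\theta\|^2)$ on $\mathbb{R}^d$; $\mathbb{E}_\theta$ is expectation under this density. Complete monotonicity of $\ell'$ means $(-1)^k\ell^{(k+1)}(t)\ge 0$ for all $t>0$ and $k=0,1,\ldots$; $\ell'(0)$ is not required to be finite. The frequentist risk of an estimator $\delta(X)$ is $R(\theta,\delta)=\mathbb{E}_\theta[L_{\omega,\ell}(\theta,\delta(X))]$. An estimator $\delta_1$ dominates $\delta_2$ if $R(\theta,\delta_1)\le R(\theta,\delta_2)$ for all $\theta\in\mathbb{R}^d$ with strict inequality for at least one $\theta$. Moment finiteness convention: the risks being compared are assumed finite. *)

theory Defs
  imports "HOL-Probability.Probability"
begin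

text \<open>The law of \<open>X\<close> when \<open>X\<close> has Lebesgue density \<open>x \<mapsto> f (\<parallel>x - \<theta>\<parallel>\<^sup>2)\<close>.\<close>

definition location_law :: "(real \<Rightarrow> real) \<Rightarrow> 'a::euclidean_space \<Rightarrow> 'a measure" where
  "location_law f \<theta> = density lborel (\<lambda>x. ennreal (f ((norm (x - \<theta>))\<^sup>2)))"

text \<open>\<open>N(\<theta>, v I)\<close>; only meant for \<open>v > 0\<close>.\<close>

definition normal_law :: "'a::euclidean_space \<Rightarrow> real \<Rightarrow> 'a measure" where
  "normal_law \<theta> v = density lborel (\<lambda>x. ennreal
     ((2 * pi * v) powr (- real DIM('a) / 2) * exp (- (norm (x - \<theta>))\<^sup>2 / (2 * v))))"

text \<open>A family \<open>P \<theta>\<close> of laws is a scale mixture of normals if it is the family of laws of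
  \<open>X\<close> with \<open>X | V \<sim> N(\<theta>, V I)\<close>, where \<open>V\<close> is almost surely positive with law \<open>G\<close>
  not depending on \<open>\<theta>\<close>.\<close>

definition normal_scale_mixture :: "('a::euclidean_space \<Rightarrow> 'a measure) \<Rightarrow> bool" where
  "normal_scale_mixture P \<longleftrightarrow>
     (\<exists>G :: real measure. prob_space G \<and> sets G = sets borel \<and> (AE v in G. 0 < v) \<and>
        (\<forall>\<theta>. \<forall>A \<in> sets borel.
           emeasure (P \<theta>) A = (\<integral>\<^sup>+ v. emeasure (normal_law \<theta> v) A \<partial>G)))"

text \<open>Finiteness of \<open>g\<close> or its derivatives at \<open>0\<close> is not required.\<close>

definition completely_monotone :: "(real \<Rightarrow> real) \<Rightarrow> bool" where
  "completely_monotone g \<longleftrightarrow>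
     (\<forall>k. \<forall>t>0. (deriv ^^ k) g differentiable (at t) \<and> 0 \<le> (- 1) ^ k * (deriv ^^ k) g t)"

text \<open>The loss of the estimate \<open>y\<close> of \<open>\<theta>\<close> when \<open>x\<close> is observed.\<close>

definition balanced_loss ::
    "real \<Rightarrow> (real \<Rightarrow> real) \<Rightarrow> 'a::euclidean_space \<Rightarrow> 'a \<Rightarrow> 'a \<Rightarrow> real" where
  "balanced_loss \<omega> l \<theta> x y = l (\<omega> * (norm (y - x))\<^sup>2 + (1 - \<omega>) * (norm (y - \<theta>))\<^sup>2)"

definition finite_risk ::
    "(real \<Rightarrow> real) \<Rightarrow> real \<Rightarrow> (real \<Rightarrow> real) \<Rightarrow> 'a::euclidean_space \<Rightarrow> ('a \<Rightarrow> 'a) \<Rightarrow> bool" where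
  "finite_risk f \<omega> l \<theta> \<delta> \<longleftrightarrow> integrable (location_law f \<theta>) (\<lambda>x. balanced_loss \<omega> l \<theta> x (\<delta> x))"

definition risk ::
    "(real \<Rightarrow> real) \<Rightarrow> real \<Rightarrow> (real \<Rightarrow> real) \<Rightarrow> 'a::euclidean_space \<Rightarrow> ('a \<Rightarrow> 'a) \<Rightarrow> real" where
  "risk f \<omega> l \<theta> \<delta> = (\<integral>x. balanced_loss \<omega> l \<theta> x (\<delta> x) \<partial>location_law f \<theta>)"

definition dominates ::
    "(real \<Rightarrow> real) \<Rightarrow> real \<Rightarrow> (real \<Rightarrow> real) \<Rightarrow> ('a::euclidean_space \<Rightarrow> 'a) \<Rightarrow> ('a \<Rightarrow> 'a) \<Rightarrow> bool" where
  "dominates f \<omega> l \<delta>\<^sub>1 \<delta>\<^sub>2 \<longleftrightarrow>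
     (\<forall>\<theta>. risk f \<omega> l \<theta> \<delta>\<^sub>1 \<le> risk f \<omega> l \<theta> \<delta>\<^sub>2) \<and> (\<exists>\<theta>. risk f \<omega> l \<theta> \<delta>\<^sub>1 < risk f \<omega> l \<theta> \<delta>\<^sub>2)"

definition baranchik :: "real \<Rightarrow> (real \<Rightarrow> real) \<Rightarrow> 'a::euclidean_space \<Rightarrow> 'a" where
  "baranchik c r x = (1 - c * r ((norm x)\<^sup>2) / (norm x)\<^sup>2) *\<^sub>R x"

definition star_kernel ::
    "(real \<Rightarrow> real) \<Rightarrow> real \<Rightarrow> (real \<Rightarrow> real) \<Rightarrow> 'a::euclidean_space \<Rightarrow> real" where
  "star_kernel f \<omega> l x = deriv l ((1 - \<omega>) * (norm x)\<^sup>2) * f ((norm x)\<^sup>2)"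

text \<open>The law with density \<open>star_kernel f \<omega> l / K\<^sub>1\<close>, \<open>K\<^sub>1\<close> being the integral of
  \<open>star_kernel f \<omega> l\<close>. If that integral diverges, then \<open>K\<^sub>1 = 0\<close> by the conventions for the
  Bochner integral and this is the null measure, hence not a probability measure.\<close>

definition star_law ::
    "(real \<Rightarrow> real) \<Rightarrow> real \<Rightarrow> (real \<Rightarrow> real) \<Rightarrow> 'a::euclidean_space measure" where
  "star_law f \<omega> l = density lborel (\<lambda>x :: 'a.
     ennreal (star_kernel f \<omega> l x / (\<integral>z. star_kernel f \<omega> l (z :: 'a) \<partial>lborel)))"

end

theory Submission
  imports Defs "HOL-Real_Asymp.Real_Asymp"
begin

text \<open>Write \<open>\<alpha> = 1 - \<omega>\<close>, and let \<open>p x = l' (\<alpha> |x|\<^sup>2) f (|x|\<^sup>2)\<close> be the unnormalised starred density.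
Set
  \<open>N = \<integral> p x dx\<close>, \<open>I = \<integral> p x / |x|\<^sup>2 dx\<close>,
  \<open>K = \<integral> p (x - \<theta>) r (|x|\<^sup>2) / |x|\<^sup>2 dx\<close>, \<open>S = \<integral> p (x - \<theta>) r (|x|\<^sup>2) (x \<bullet> (x - \<theta>)) / |x|\<^sup>2 dx\<close>.
A completely monotone \<open>l'\<close> makes \<open>l\<close> concave, so the loss lies below its tangent at \<open>\<alpha> |x - \<theta>|\<^sup>2\<close>; since
\<open>r\<^sup>2 \<le> r\<close>, the risk of the Baranchik estimator exceeds that of \<open>X\<close> by at most \<open>a \<alpha>\<^sup>2 (a K - 2 S)\<close>
(\<open>balanced_loss_baranchik_le\<close>). The condition on \<open>a\<close> says \<open>a < 2 N / I\<close>. Hence everything follows from the one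
inequality \<open>N K \<le> I S\<close> together with \<open>K > 0\<close>: then \<open>a K - 2 S \<le> (a - 2 N / I) K < 0\<close>.

For a Gaussian kernel \<open>exp (- \<kappa> |x|\<^sup>2)\<close> in dimension \<open>d\<close> three facts hold: \<open>(d - 2) I = 2 \<kappa> N\<close>;
\<open>(d - 2) K \<le> 2 \<kappa> S\<close>, an inequality form of Stein's identity (\<open>gauss_stein\<close>); and \<open>K / (\<kappa> N)\<close> decreases in
\<open>\<kappa>\<close> (\<open>gauss_shrink_rate_antimono\<close>). They combine to a symmetric inequality for two Gaussian kernels
(\<open>gauss_pair_inequality\<close>), which is the pointwise form of Chebyshev's association inequality. Integrating it against
the mixing measure in both arguments gives \<open>N K \<le> I S\<close> for every mixture of Gaussian kernels
(\<open>shrinkage_inequality_gauss_mixture\<close>).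

It remains to see that \<open>p\<close> is, up to limits, such a mixture. By Bernstein's theorem a completely monotone \<open>g\<close> is a
mixture of exponentials, but an elementary approximation is enough: the Taylor series of \<open>g\<close> about \<open>\<epsilon> + n\<close>
converges on the left with nonnegative terms in powers of the distance, so \<open>t \<mapsto> g (\<epsilon> + n (1 - exp (- t / n)))\<close> is a
power series in \<open>exp (- t / n)\<close> with nonnegative coefficients, that is, a discrete mixture of exponentials
(\<open>completely_monotone_expansion_exp\<close>). Its product with a Gaussian mixture is again a Gaussian mixture. As
\<open>n \<rightarrow> \<infinity>\<close> it tends to \<open>g (\<epsilon> + t)\<close>, and two applications of dominated convergence, first in \<open>n\<close> and then in
\<open>\<epsilon> \<rightarrow> 0\<close>, carry the inequality over to \<open>p\<close> (\<open>shrinkage_inequality_weighted\<close>).\<close>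

section \<open>Affine changes of variables and monotonicity under shifts\<close>

lemma nn_integral_lborel_affine:
  fixes F :: "'a::euclidean_space \<Rightarrow> ennreal"
  assumes [measurable]: "F \<in> borel_measurable borel" and "c \<noteq> 0"
  shows "(\<integral>\<^sup>+x. F x \<partial>lborel) = ennreal (\<bar>c\<bar> ^ DIM('a)) * (\<integral>\<^sup>+x. F (t + c *\<^sub>R x) \<partial>lborel)"
  by (subst lborel_affine[OF assms(2), of t])
     (simp add: nn_integral_density nn_integral_distr nn_integral_cmult)

lemma integral_lborel_affine:
  fixes F :: "'a::euclidean_space \<Rightarrow> real"
  assumes [measurable]: "F \<in> borel_measurable borel" and "c \<noteq> 0"
  shows "(\<integral>x. F x \<partial>lborel) = \<bar>c\<bar> ^ DIM('a) * (\<integral>x. F (t + c *\<^sub>R x) \<partial>lborel)"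
  by (subst lborel_affine[OF assms(2), of t])
     (simp add: integral_density integral_distr)

lemma integrable_lborel_affine:
  fixes F :: "'a::euclidean_space \<Rightarrow> real"
  assumes F: "integrable lborel F" and "c \<noteq> 0"
  shows "integrable lborel (\<lambda>x. F (t + c *\<^sub>R x))"
proof -
  have [measurable]: "F \<in> borel_measurable borel"
    using F by auto
  have "integrable (density (distr lborel borel (\<lambda>x. t + c *\<^sub>R x)) (\<lambda>_. \<bar>c\<bar> ^ DIM('a))) F"
    using F unfolding lborel_affine[OF assms(2), of t, symmetric] .
  then show ?thesis
    using assms(2) by (simp add: integrable_density integrable_distr_eq)
qed

lemma rearrangement_ennreal:
  fixes a b a' b' :: ennreal
  assumes "a' \<le> a" "b' \<le> b"
  shows "a' * b + a * b' \<le> a * b + a' * b'"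
proof -
  obtain e where e: "a = a' + e" using assms(1) by (auto simp: le_iff_add)
  obtain e' where e': "b = b' + e'" using assms(2) by (auto simp: le_iff_add)
  show ?thesis
    unfolding e e' by (auto simp: distrib_left distrib_right add_ac)
qed

text \<open>The origin is exempt as an upper bound, because kernels such as \<open>1 / |x|\<^sup>2\<close> carry the default value \<open>0\<close> there.\<close>

definition radially_decreasing :: "('a::euclidean_space \<Rightarrow> 'b::order) \<Rightarrow> bool" where
  "radially_decreasing p \<longleftrightarrow> (\<forall>x y. x \<noteq> 0 \<longrightarrow> norm x \<le> norm y \<longrightarrow> p y \<le> p x)"

lemma radially_decreasingD:
  "radially_decreasing p \<Longrightarrow> x \<noteq> 0 \<Longrightarrow> norm x \<le> norm y \<Longrightarrow> p y \<le> p x"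
  by (auto simp: radially_decreasing_def)

lemma radially_decreasing_eq:
  assumes "radially_decreasing p" "x \<noteq> 0" "norm x = norm y"
  shows "p x = p y"
proof (rule antisym)
  have "y \<noteq> 0" using assms by auto
  then show "p x \<le> p y" using assms by (intro radially_decreasingD[OF assms(1)]) auto
  show "p y \<le> p x" using assms by (intro radially_decreasingD[OF assms(1)]) auto
qed

text \<open>The overlap of two radially decreasing functions shrinks as one of them moves away along a ray. Point reflection
\<open>\<sigma>\<close> in the midpoint of the two centres exchanges the shifted copies of \<open>A\<close>; because the origin lies on the same
line, on the side of \<open>c *\<^sub>R \<theta>\<close>, a point is closer to \<open>c *\<^sub>R \<theta>\<close> than to \<open>c' *\<^sub>R \<theta>\<close> exactly when it is
closer to the origin than its mirror image. Pairing each point with its image reduces the claim to the rearrangement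
inequality.\<close>

lemma nn_integral_shift_antimono:
  fixes A B :: "'a::euclidean_space \<Rightarrow> ennreal"
  assumes [measurable]: "A \<in> borel_measurable borel" "B \<in> borel_measurable borel"
    and A: "radially_decreasing A" and B: "radially_decreasing B"
    and c: "0 \<le> c" "c \<le> c'"
  shows "(\<integral>\<^sup>+x. A (x - c' *\<^sub>R \<theta>) * B x \<partial>lborel) \<le> (\<integral>\<^sup>+x. A (x - c *\<^sub>R \<theta>) * B x \<partial>lborel)"
    (is "?I' \<le> ?I")
proof (cases "c = c'")
  case False
  define \<sigma> where "\<sigma> x = (c + c') *\<^sub>R \<theta> - x" for x
  have \<sigma>[measurable]: "\<sigma> \<in> borel_measurable borel"
    unfolding \<sigma>_def by measurable
  have AE: "AE x in lborel. x \<noteq> 0 \<and> \<sigma> x \<noteq> 0 \<and> x - c *\<^sub>R \<theta> \<noteq> 0 \<and> x - c' *\<^sub>R \<theta> \<noteq> 0"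
    using AE_lborel_singleton[of 0] AE_lborel_singleton[of "(c + c') *\<^sub>R \<theta>"]
      AE_lborel_singleton[of "c *\<^sub>R \<theta>"] AE_lborel_singleton[of "c' *\<^sub>R \<theta>"]
    by eventually_elim (auto simp: \<sigma>_def)
  have swap: "(\<integral>\<^sup>+x. G (\<sigma> x) \<partial>lborel) = (\<integral>\<^sup>+x. G x \<partial>lborel)"
    if [measurable]: "G \<in> borel_measurable borel" for G :: "'a \<Rightarrow> ennreal"
    using nn_integral_lborel_affine[of G "-1" "(c + c') *\<^sub>R \<theta>"] by (simp add: \<sigma>_def)
  have norm_\<sigma>: "norm (\<sigma> x - c' *\<^sub>R \<theta>) = norm (x - c *\<^sub>R \<theta>)"
    "norm (\<sigma> x - c *\<^sub>R \<theta>) = norm (x - c' *\<^sub>R \<theta>)" for x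
    by (subst norm_minus_commute, simp add: \<sigma>_def algebra_simps)+
  have I'_alt: "(\<integral>\<^sup>+x. A (x - c *\<^sub>R \<theta>) * B (\<sigma> x) \<partial>lborel) = ?I'"
  proof -
    have "?I' = (\<integral>\<^sup>+x. A (\<sigma> x - c' *\<^sub>R \<theta>) * B (\<sigma> x) \<partial>lborel)"
      by (rule swap[symmetric]) measurable
    also have "\<dots> = (\<integral>\<^sup>+x. A (x - c *\<^sub>R \<theta>) * B (\<sigma> x) \<partial>lborel)"
      using AE by (intro nn_integral_cong_AE, eventually_elim)
        (simp add: radially_decreasing_eq[OF A _ norm_\<sigma>(1)[symmetric]])
    finally show ?thesis by simp
  qed
  have I_alt: "(\<integral>\<^sup>+x. A (x - c' *\<^sub>R \<theta>) * B (\<sigma> x) \<partial>lborel) = ?I"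
  proof -
    have "?I = (\<integral>\<^sup>+x. A (\<sigma> x - c *\<^sub>R \<theta>) * B (\<sigma> x) \<partial>lborel)"
      by (rule swap[symmetric]) measurable
    also have "\<dots> = (\<integral>\<^sup>+x. A (x - c' *\<^sub>R \<theta>) * B (\<sigma> x) \<partial>lborel)"
      using AE by (intro nn_integral_cong_AE, eventually_elim)
        (simp add: radially_decreasing_eq[OF A _ norm_\<sigma>(2)[symmetric]])
    finally show ?thesis by simp
  qed
  have pointwise: "A (x - c' *\<^sub>R \<theta>) * B x + A (x - c *\<^sub>R \<theta>) * B (\<sigma> x)
      \<le> A (x - c *\<^sub>R \<theta>) * B x + A (x - c' *\<^sub>R \<theta>) * B (\<sigma> x)"
    if x: "x \<noteq> 0 \<and> \<sigma> x \<noteq> 0 \<and> x - c *\<^sub>R \<theta> \<noteq> 0 \<and> x - c' *\<^sub>R \<theta> \<noteq> 0" for x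
  proof -
    have n1: "(norm (x - c' *\<^sub>R \<theta>))\<^sup>2 - (norm (x - c *\<^sub>R \<theta>))\<^sup>2
        = (c' - c) * ((c + c') * (norm \<theta>)\<^sup>2 - 2 * (x \<bullet> \<theta>))"
      unfolding power2_norm_eq_inner by (simp add: inner_diff_left inner_diff_right inner_commute algebra_simps)
    have n2: "(norm (\<sigma> x))\<^sup>2 - (norm x)\<^sup>2 = (c + c') * ((c + c') * (norm \<theta>)\<^sup>2 - 2 * (x \<bullet> \<theta>))"
      unfolding power2_norm_eq_inner \<sigma>_def by (simp add: inner_diff_left inner_diff_right inner_commute algebra_simps)
    show ?thesis
    proof (cases "0 \<le> (c + c') * (norm \<theta>)\<^sup>2 - 2 * (x \<bullet> \<theta>)")
      case True
      have "0 \<le> (norm (x - c' *\<^sub>R \<theta>))\<^sup>2 - (norm (x - c *\<^sub>R \<theta>))\<^sup>2" "0 \<le> (norm (\<sigma> x))\<^sup>2 - (norm x)\<^sup>2"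
        unfolding n1 n2 using True c by auto
      then have "norm (x - c *\<^sub>R \<theta>) \<le> norm (x - c' *\<^sub>R \<theta>)" "norm x \<le> norm (\<sigma> x)"
        by (auto simp: norm_le_square power2_norm_eq_inner norm_le)
      then show ?thesis
        using x by (intro rearrangement_ennreal radially_decreasingD[OF A] radially_decreasingD[OF B]) auto
    next
      case False
      have "(norm (x - c' *\<^sub>R \<theta>))\<^sup>2 - (norm (x - c *\<^sub>R \<theta>))\<^sup>2 \<le> 0" "(norm (\<sigma> x))\<^sup>2 - (norm x)\<^sup>2 \<le> 0"
        unfolding n1 n2 using False c by (auto intro!: mult_nonneg_nonpos)
      then have "norm (x - c' *\<^sub>R \<theta>) \<le> norm (x - c *\<^sub>R \<theta>)" "norm (\<sigma> x) \<le> norm x"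
        by (auto simp: power2_norm_eq_inner norm_le)
      then have "A (x - c *\<^sub>R \<theta>) * B (\<sigma> x) + A (x - c' *\<^sub>R \<theta>) * B x
        \<le> A (x - c' *\<^sub>R \<theta>) * B (\<sigma> x) + A (x - c *\<^sub>R \<theta>) * B x"
        using x by (intro rearrangement_ennreal radially_decreasingD[OF A] radially_decreasingD[OF B]) auto
      then show ?thesis by (simp add: add_ac)
    qed
  qed
  have "?I' + ?I' = (\<integral>\<^sup>+x. A (x - c' *\<^sub>R \<theta>) * B x + A (x - c *\<^sub>R \<theta>) * B (\<sigma> x) \<partial>lborel)"
    by (subst nn_integral_add) (auto simp: I'_alt)
  also have "\<dots> \<le> (\<integral>\<^sup>+x. A (x - c *\<^sub>R \<theta>) * B x + A (x - c' *\<^sub>R \<theta>) * B (\<sigma> x) \<partial>lborel)"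
    using AE by (intro nn_integral_mono_AE, eventually_elim) (rule pointwise)
  also have "\<dots> = ?I + ?I"
    by (subst nn_integral_add) (auto simp: I_alt)
  finally have "?I' + ?I' \<le> ?I + ?I" .
  show ?thesis
  proof (rule ccontr)
    assume "\<not> ?I' \<le> ?I"
    then have less: "?I < ?I'" by simp
    then have "?I + ?I < ?I + ?I'"
      by (auto simp: ennreal_add_left_cancel_less)
    also have "\<dots> \<le> ?I' + ?I'"
      using less by (intro add_right_mono) simp
    finally show False
      using \<open>?I' + ?I' \<le> ?I + ?I\<close> by simp
  qed
qed simp

section \<open>Gaussian kernels\<close>

definition gauss :: "real \<Rightarrow> 'a::euclidean_space \<Rightarrow> real" where
  "gauss \<kappa> x = exp (- \<kappa> * (norm x)\<^sup>2)"

lemma gauss_pos [simp]: "0 < gauss \<kappa> x" and gauss_nonneg [simp]: "0 \<le> gauss \<kappa> x"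
  by (auto simp: gauss_def)

lemma borel_measurable_gauss [measurable]: "gauss \<kappa> \<in> borel_measurable borel"
  unfolding gauss_def by measurable

lemma nn_integral_gauss:
  assumes "0 < \<kappa>"
  shows "(\<integral>\<^sup>+(x::'a::euclidean_space). gauss \<kappa> x \<partial>lborel) = ennreal (sqrt (pi / \<kappa>) ^ DIM('a))"
proof -
  \<comment> \<open>The standard deviation for which the normal density is proportional to \<open>exp (- \<kappa> * x\<^sup>2)\<close>.\<close>
  define \<sigma> where "\<sigma> = 1 / sqrt (2 * \<kappa>)"
  have \<sigma>: "0 < \<sigma>" "2 * \<sigma>\<^sup>2 = 1 / \<kappa>"
    using assms by (auto simp: \<sigma>_def power_divide)
  have one_dim: "(\<integral>\<^sup>+x. ennreal (exp (- \<kappa> * x\<^sup>2)) \<partial>lborel) = ennreal (sqrt (pi / \<kappa>))"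
  proof -
    have "ennreal (exp (- \<kappa> * x\<^sup>2)) = ennreal (sqrt (pi / \<kappa>)) * ennreal (normal_density 0 \<sigma> x)" for x
    proof -
      have "2 * pi * \<sigma>\<^sup>2 = pi * (2 * \<sigma>\<^sup>2)" by simp
      then have "2 * pi * \<sigma>\<^sup>2 = pi / \<kappa>" "x\<^sup>2 / (2 * \<sigma>\<^sup>2) = \<kappa> * x\<^sup>2"
        unfolding \<sigma>(2) by auto
      then show ?thesis
        using assms by (simp add: normal_density_def ennreal_mult[symmetric])
    qed
    then show ?thesis
      using \<sigma>(1) by (simp add: nn_integral_cmult nn_integral_eq_integral normal_density_nonneg)
  qed
  have "(\<integral>\<^sup>+(x::'a). gauss \<kappa> x \<partial>lborel)
      = (\<integral>\<^sup>+(x::'a). (\<Prod>b\<in>Basis. ennreal (exp (- \<kappa> * (x \<bullet> b)\<^sup>2))) \<partial>lborel)"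
  proof (intro nn_integral_cong)
    fix x :: 'a
    have "(norm x)\<^sup>2 = (\<Sum>b\<in>Basis. (x \<bullet> b)\<^sup>2)"
      unfolding power2_norm_eq_inner by (subst euclidean_inner) (simp add: power2_eq_square)
    then show "ennreal (gauss \<kappa> x) = (\<Prod>b\<in>Basis. ennreal (exp (- \<kappa> * (x \<bullet> b)\<^sup>2)))"
      by (simp add: gauss_def sum_distrib_left exp_sum prod_ennreal flip: sum_negf)
  qed
  also have "\<dots> = (\<Prod>b\<in>(Basis :: 'a set). \<integral>\<^sup>+x. ennreal (exp (- \<kappa> * x\<^sup>2)) \<partial>lborel)"
    by (rule nn_integral_lborel_prod) auto
  also have "\<dots> = ennreal (sqrt (pi / \<kappa>) ^ DIM('a))"
    unfolding one_dim using assms by (simp add: ennreal_power)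
  finally show ?thesis .
qed

lemma integrable_gauss: "0 < \<kappa> \<Longrightarrow> integrable lborel (gauss \<kappa> :: 'a::euclidean_space \<Rightarrow> real)"
  by (rule integrableI_nonneg) (auto simp: nn_integral_gauss)

lemma integral_gauss:
  "0 < \<kappa> \<Longrightarrow> (\<integral>(x::'a::euclidean_space). gauss \<kappa> x \<partial>lborel) = sqrt (pi / \<kappa>) ^ DIM('a)"
  by (subst integral_eq_nn_integral) (auto simp: nn_integral_gauss)

text \<open>Since \<open>1 / |x|\<^sup>2 = \<integral>\<^sub>0\<^sup>\<infinity> exp (- s |x|\<^sup>2) ds\<close>, the weight \<open>1 / |x|\<^sup>2\<close> turns the kernel of rate \<open>\<kappa>\<close> into an
integral of kernels of rates \<open>s \<ge> \<kappa>\<close>, whose masses are proportional to \<open>s powr (- d / 2)\<close>; this is integrable at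
infinity exactly when \<open>d \<ge> 3\<close>.\<close>

lemma nn_integral_gauss_inverse:
  assumes \<kappa>: "0 < \<kappa>" and dim: "3 \<le> DIM('a::euclidean_space)"
  shows "(\<integral>\<^sup>+(x::'a). gauss \<kappa> x / (norm x)\<^sup>2 \<partial>lborel)
    = ennreal (2 * \<kappa> / (DIM('a) - 2) * sqrt (pi / \<kappa>) ^ DIM('a))"
proof -
  define k where "k = real DIM('a) / 2"
  have k: "1 < k" using dim by (simp add: k_def)
  have mass: "sqrt (pi / s) ^ DIM('a) = pi powr k * s powr (- k)" if "0 < s" for s
  proof -
    have "sqrt (pi / s) ^ DIM('a) = (pi / s) powr k"
      using that by (simp add: powr_half_sqrt[symmetric] powr_realpow[symmetric] powr_powr k_def)
    then show ?thesis
      using that by (simp add: powr_divide powr_minus_divide)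
  qed
  have "(\<integral>\<^sup>+(x::'a). gauss \<kappa> x / (norm x)\<^sup>2 \<partial>lborel)
      = (\<integral>\<^sup>+(x::'a). \<integral>\<^sup>+s. ennreal (gauss s x) * indicator {\<kappa>..} s \<partial>lborel \<partial>lborel)"
    using AE_lborel_singleton[of 0]
  proof (intro nn_integral_cong_AE, eventually_elim)
    fix x :: 'a assume x: "x \<noteq> 0"
    have "(\<integral>\<^sup>+s. ennreal (gauss s x) * indicator {\<kappa>..} s \<partial>lborel)
        = 0 - (- exp (- \<kappa> * (norm x)\<^sup>2) / (norm x)\<^sup>2)"
    proof (rule nn_integral_FTC_atLeast)
      show "((\<lambda>s. - exp (- s * (norm x)\<^sup>2) / (norm x)\<^sup>2) \<longlongrightarrow> 0) at_top"
      proof -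
        have "0 < (norm x)\<^sup>2" using x by simp
        then show ?thesis by real_asymp
      qed
      have deriv: "((\<lambda>s. - exp (- s * c) / c) has_real_derivative exp (- s * c)) (at s)" if "c \<noteq> 0" for s c :: real
        using that by (auto intro!: derivative_eq_intros)
      show "((\<lambda>s. - exp (- s * (norm x)\<^sup>2) / (norm x)\<^sup>2) has_real_derivative gauss s x) (at s)" for s
        unfolding gauss_def by (rule deriv) (use x in simp)
    qed (auto simp: gauss_def)
    then show "ennreal (gauss \<kappa> x / (norm x)\<^sup>2)
      = (\<integral>\<^sup>+s. ennreal (gauss s x) * indicator {\<kappa>..} s \<partial>lborel)"
      by (simp add: gauss_def)
  qed
  also have "\<dots> = (\<integral>\<^sup>+s. \<integral>\<^sup>+(x::'a). ennreal (gauss s x) * indicator {\<kappa>..} s \<partial>lborel \<partial>lborel)"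
    by (rule lborel_pair.Fubini') (simp add: gauss_def)
  also have "\<dots> = (\<integral>\<^sup>+s. ennreal (pi powr k * s powr (- k)) * indicator {\<kappa>..} s \<partial>lborel)"
    using \<kappa> by (intro nn_integral_cong)
      (auto simp: nn_integral_multc nn_integral_gauss mass split: split_indicator)
  also have "\<dots> = 0 - (- (pi powr k * \<kappa> powr (1 - k) / (k - 1)))"
  proof (rule nn_integral_FTC_atLeast)
    show "((\<lambda>s. - (pi powr k * s powr (1 - k) / (k - 1))) \<longlongrightarrow> 0) at_top"
      using k by real_asymp
    show "((\<lambda>s. - (pi powr k * s powr (1 - k) / (k - 1))) has_real_derivative pi powr k * s powr (- k)) (at s)"
      if "\<kappa> \<le> s" for s
    proof -
      have "((\<lambda>s. - (pi powr k / (k - 1)) * s powr (1 - k)) has_real_derivative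
          - (pi powr k / (k - 1)) * ((1 - k) * s powr (1 - k - 1))) (at s)"
        using that \<kappa> by (intro DERIV_cmult has_real_derivative_powr) auto
      moreover have "- (pi powr k / (k - 1)) * ((1 - k) * s powr (1 - k - 1)) = pi powr k * s powr (- k)"
        using k by (simp add: divide_simps) (simp add: algebra_simps)
      ultimately show ?thesis
        by simp
    qed
  qed auto
  also have "0 - (- (pi powr k * \<kappa> powr (1 - k) / (k - 1)))
      = 2 * \<kappa> / (DIM('a) - 2) * sqrt (pi / \<kappa>) ^ DIM('a)"
  proof -
    have "\<kappa> powr (1 - k) = \<kappa> * \<kappa> powr (- k)" using \<kappa> by (simp add: powr_diff powr_minus divide_inverse)
    moreover have "real (DIM('a) - 2) = 2 * (k - 1)" using dim by (simp add: k_def of_nat_diff)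
    then have "2 * \<kappa> / real (DIM('a) - 2) = \<kappa> / (k - 1)"
      by (simp only: mult_divide_mult_cancel_left[OF zero_neq_numeral[symmetric]])
    ultimately show ?thesis unfolding mass[OF \<kappa>] by simp
  qed
  finally show ?thesis .
qed

lemma integrable_gauss_inverse:
  assumes "0 < \<kappa>" and "3 \<le> DIM('a::euclidean_space)"
  shows "integrable lborel (\<lambda>x :: 'a. gauss \<kappa> x / (norm x)\<^sup>2)"
  by (rule integrableI_nonneg) (auto simp: nn_integral_gauss_inverse[OF assms])

lemma integral_gauss_inverse:
  assumes "0 < \<kappa>" and "3 \<le> DIM('a::euclidean_space)"
  shows "(\<integral>(x::'a). gauss \<kappa> x / (norm x)\<^sup>2 \<partial>lborel)
      = 2 * \<kappa> / (DIM('a) - 2) * (\<integral>(x::'a). gauss \<kappa> x \<partial>lborel)"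
proof -
  have "(\<integral>(x::'a). gauss \<kappa> x / (norm x)\<^sup>2 \<partial>lborel)
      = enn2real (\<integral>\<^sup>+(x::'a). gauss \<kappa> x / (norm x)\<^sup>2 \<partial>lborel)"
    by (rule integral_eq_nn_integral) auto
  then show ?thesis
    unfolding nn_integral_gauss_inverse[OF assms] integral_gauss[OF assms(1)]
    using assms by simp
qed

section \<open>Shrinkage functions and radial kernels\<close>

text \<open>The derivative conditions on \<open>r\<close> enter the argument only through monotonicity of \<open>r\<close> and of the ratio.\<close>

definition shrinkage :: "(real \<Rightarrow> real) \<Rightarrow> bool" where
  "shrinkage r \<longleftrightarrow> (\<forall>t>0. 0 \<le> r t \<and> r t \<le> 1) \<and> mono_on {0<..} r \<and>
     (\<forall>s t. 0 < s \<longrightarrow> s \<le> t \<longrightarrow> r t / t \<le> r s / s)"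

definition shrink :: "(real \<Rightarrow> real) \<Rightarrow> 'a::euclidean_space \<Rightarrow> real" where
  "shrink r x = r ((norm x)\<^sup>2) / (norm x)\<^sup>2"

lemma shrink_0 [simp]: "shrink r 0 = 0"
  by (simp add: shrink_def)

lemma shrink_nonneg: "shrinkage r \<Longrightarrow> 0 \<le> shrink r x"
  by (cases "x = 0") (auto simp: shrink_def shrinkage_def)

lemma shrink_le: "shrinkage r \<Longrightarrow> shrink r x \<le> 1 / (norm x)\<^sup>2"
  by (cases "x = 0") (auto simp: shrink_def shrinkage_def divide_right_mono)

lemma norm_power2_shrink_le: "shrinkage r \<Longrightarrow> (norm x)\<^sup>2 * shrink r x \<le> 1"
  by (cases "x = 0") (auto simp: shrink_def shrinkage_def)

lemma radially_decreasing_shrink: "shrinkage r \<Longrightarrow> radially_decreasing (shrink r)"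
  by (auto simp: radially_decreasing_def shrink_def shrinkage_def)

lemma shrink_scaleR_ge:
  assumes r: "shrinkage r" and c: "1 \<le> c"
  shows "shrink r x \<le> c\<^sup>2 * shrink r (c *\<^sub>R x)"
proof (cases "x = 0")
  case False
  have "r ((norm x)\<^sup>2) \<le> r ((norm (c *\<^sub>R x))\<^sup>2)"
    using r c False mult_right_mono[of 1 "c\<^sup>2" "(norm x)\<^sup>2"] unfolding shrinkage_def
    by (intro mono_onD[of "{0<..}" r]) (auto simp: power_mult_distrib)
  then show ?thesis
    using c False by (simp add: shrink_def power_mult_distrib divide_right_mono)
qed simp

text \<open>Nothing is known about \<open>r\<close> on the nonpositive reals, but \<open>shrink r\<close> does not see it: replacing \<open>r\<close> by \<open>0\<close> there makes it monotone, hence Borel.\<close>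

lemma borel_measurable_shrink:
  assumes r: "shrinkage r"
  shows "shrink r \<in> borel_measurable (borel :: 'a::euclidean_space measure)"
proof -
  define r' where "r' t = (if 0 < t then r t else 0)" for t
  have "mono r'"
    using r by (auto simp: mono_def r'_def shrinkage_def mono_on_def)
  then have [measurable]: "r' \<in> borel_measurable borel"
    by (rule borel_measurable_mono)
  have "(\<lambda>x :: 'a. r' ((norm x)\<^sup>2) / (norm x)\<^sup>2) \<in> borel_measurable borel"
    by measurable
  moreover have "(\<lambda>x :: 'a. r' ((norm x)\<^sup>2) / (norm x)\<^sup>2) = shrink r"
    by (auto simp: fun_eq_iff shrink_def r'_def)
  ultimately show ?thesis
    by simp
qed

text \<open>The kernels for which all integrals of the argument are finite. Sign and monotonicity are required away from the
origin only: a kernel \<open>l' (\<alpha> |x|\<^sup>2) f (|x|\<^sup>2)\<close> may be singular at \<open>0\<close>, where its value is arbitrary.\<close>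

definition radial_kernel :: "('a::euclidean_space \<Rightarrow> real) \<Rightarrow> bool" where
  "radial_kernel p \<longleftrightarrow> (\<forall>x. x \<noteq> 0 \<longrightarrow> 0 \<le> p x) \<and> radially_decreasing p \<and> integrable lborel p \<and>
     integrable lborel (\<lambda>x. p x * (norm x)\<^sup>2) \<and> integrable lborel (\<lambda>x. p x / (norm x)\<^sup>2)"

lemma radial_kernel_nonneg: "radial_kernel p \<Longrightarrow> x \<noteq> 0 \<Longrightarrow> 0 \<le> p x"
  by (auto simp: radial_kernel_def)

lemma AE_shift_nonzero: "AE x in lborel. x \<noteq> 0 \<and> x - \<theta> \<noteq> (0::'a::euclidean_space)"
  using AE_lborel_singleton[of 0] AE_lborel_singleton[of \<theta>] by eventually_elim auto

lemma integrable_lborel_shift: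
  fixes F :: "'a::euclidean_space \<Rightarrow> real"
  shows "integrable lborel F \<Longrightarrow> integrable lborel (\<lambda>x. F (x - \<theta>))"
  using integrable_lborel_affine[of F 1 "- \<theta>"] by simp

lemma radial_kernel_measurable: "radial_kernel p \<Longrightarrow> p \<in> borel_measurable borel"
  by (auto simp: radial_kernel_def)

lemma nn_integral_kernel_shift_antimono:
  fixes p q :: "'a::euclidean_space \<Rightarrow> real"
  assumes p: "radial_kernel p" and [measurable]: "q \<in> borel_measurable borel"
    and q: "radially_decreasing q" and c: "0 \<le> c" "c \<le> c'"
    and q0: "\<And>x. 0 \<le> q x"
  shows "(\<integral>\<^sup>+x. ennreal (p (x - c' *\<^sub>R \<theta>) * q x) \<partial>lborel)
    \<le> (\<integral>\<^sup>+x. ennreal (p (x - c *\<^sub>R \<theta>) * q x) \<partial>lborel)"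
proof -
  have [measurable]: "p \<in> borel_measurable borel"
    using p by (rule radial_kernel_measurable)
  have "radially_decreasing (\<lambda>x. ennreal (p x))" "radially_decreasing (\<lambda>x. ennreal (q x))"
    using p q by (auto simp: radially_decreasing_def radial_kernel_def intro!: ennreal_leI)
  from nn_integral_shift_antimono[OF _ _ this c, of \<theta>]
  have "(\<integral>\<^sup>+x. ennreal (p (x - c' *\<^sub>R \<theta>)) * ennreal (q x) \<partial>lborel)
    \<le> (\<integral>\<^sup>+x. ennreal (p (x - c *\<^sub>R \<theta>)) * ennreal (q x) \<partial>lborel)"
    by simp
  moreover have "ennreal (p (x - e *\<^sub>R \<theta>) * q x) = ennreal (p (x - e *\<^sub>R \<theta>)) * ennreal (q x)" for e x
    using q0 by (simp add: ennreal_mult'')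
  ultimately show ?thesis
    by simp
qed

text \<open>Moving the kernel away from the singularity of \<open>1 / |x|\<^sup>2\<close> can only lower the integral, so finiteness at \<open>\<theta> = 0\<close> suffices.\<close>

lemma integrable_shifted_kernel_inverse:
  fixes p :: "'a::euclidean_space \<Rightarrow> real"
  assumes p: "radial_kernel p"
  shows "integrable lborel (\<lambda>x. p (x - \<theta>) / (norm x)\<^sup>2)"
proof -
  have [measurable]: "p \<in> borel_measurable borel"
    using p by (rule radial_kernel_measurable)
  have "radially_decreasing (\<lambda>x :: 'a. 1 / (norm x)\<^sup>2)"
    by (auto simp: radially_decreasing_def intro!: divide_left_mono mult_pos_pos)
  from nn_integral_kernel_shift_antimono[OF p _ this, of 0 1 \<theta>]
  have "(\<integral>\<^sup>+x. ennreal (p (x - \<theta>) / (norm x)\<^sup>2) \<partial>lborel) \<le> (\<integral>\<^sup>+x. ennreal (p x / (norm x)\<^sup>2) \<partial>lborel)"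
    by simp
  also have "\<dots> < \<infinity>"
  proof -
    have "(\<integral>\<^sup>+x. ennreal (p x / (norm x)\<^sup>2) \<partial>lborel) \<le> (\<integral>\<^sup>+x. ennreal (norm (p x / (norm x)\<^sup>2)) \<partial>lborel)"
      by (intro nn_integral_mono ennreal_leI) (simp only: real_norm_def abs_ge_self)
    also have "\<dots> < \<infinity>"
      using p by (auto simp: radial_kernel_def integrable_iff_bounded)
    finally show ?thesis .
  qed
  finally have fin: "(\<integral>\<^sup>+x. ennreal (p (x - \<theta>) / (norm x)\<^sup>2) \<partial>lborel) < \<infinity>" .
  show ?thesis
  proof (rule integrableI_nonneg)
    show "AE x in lborel. 0 \<le> p (x - \<theta>) / (norm x)\<^sup>2"
      using AE_shift_nonzero[of \<theta>] by eventually_elim (use p in \<open>auto simp: radial_kernel_def\<close>)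
  qed (use fin in auto)
qed

lemma integrable_kernel_shrink:
  assumes p: "radial_kernel p" and r: "shrinkage r"
  shows "integrable lborel (\<lambda>x. p (x - \<theta>) * shrink r x)"
proof (rule Bochner_Integration.integrable_bound[OF integrable_shifted_kernel_inverse[OF p, of \<theta>]])
  have [measurable]: "p \<in> borel_measurable borel" "shrink r \<in> borel_measurable borel"
    using p r by (auto intro: radial_kernel_measurable borel_measurable_shrink)
  show "(\<lambda>x. p (x - \<theta>) * shrink r x) \<in> borel_measurable lborel"
    by measurable
  have "norm (p (x - \<theta>) * shrink r x) \<le> norm (p (x - \<theta>) / (norm x)\<^sup>2)" for x
    using shrink_nonneg[OF r, of x] shrink_le[OF r, of x] 
      mult_left_mono[of "shrink r x" "1 / (norm x)\<^sup>2" "\<bar>p (x - \<theta>)\<bar>"]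
    by (simp add: abs_mult)
  then show "AE x in lborel. norm (p (x - \<theta>) * shrink r x) \<le> norm (p (x - \<theta>) / (norm x)\<^sup>2)"
    by simp
qed

text \<open>By Cauchy-Schwarz and \<open>r \<le> 1\<close> the weight is at most \<open>|x - \<theta>| / |x| \<le> 1 / |x|\<^sup>2 + |x - \<theta>|\<^sup>2\<close>, so a second moment
and an inverse second moment are enough.\<close>

lemma integrable_kernel_shrink_inner:
  assumes p: "radial_kernel p" and r: "shrinkage r"
  shows "integrable lborel (\<lambda>x. p (x - \<theta>) * (shrink r x * (x \<bullet> (x - \<theta>))))"
proof (rule Bochner_Integration.integrable_bound)
  have [measurable]: "p \<in> borel_measurable borel" "shrink r \<in> borel_measurable borel"
    using p r by (auto intro: radial_kernel_measurable borel_measurable_shrink)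
  show "(\<lambda>x. p (x - \<theta>) * (shrink r x * (x \<bullet> (x - \<theta>)))) \<in> borel_measurable lborel"
    by measurable
  show "integrable lborel (\<lambda>x. p (x - \<theta>) / (norm x)\<^sup>2 + p (x - \<theta>) * (norm (x - \<theta>))\<^sup>2)"
    using p by (intro Bochner_Integration.integrable_add integrable_shifted_kernel_inverse
        integrable_lborel_shift[of "\<lambda>x. p x * (norm x)\<^sup>2"]) (auto simp: radial_kernel_def)
  show "AE x in lborel. norm (p (x - \<theta>) * (shrink r x * (x \<bullet> (x - \<theta>))))
      \<le> norm (p (x - \<theta>) / (norm x)\<^sup>2 + p (x - \<theta>) * (norm (x - \<theta>))\<^sup>2)"
    using AE_shift_nonzero[of \<theta>]
  proof eventually_elim
    fix x assume x: "x \<noteq> 0 \<and> x - \<theta> \<noteq> 0"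
    have "\<bar>shrink r x * (x \<bullet> (x - \<theta>))\<bar> \<le> 1 / (norm x)\<^sup>2 * (norm x * norm (x - \<theta>))"
      unfolding abs_mult using shrink_nonneg[OF r, of x] shrink_le[OF r, of x]
      by (intro mult_mono Cauchy_Schwarz_ineq2) auto
    also have "\<dots> = 1 / norm x * norm (x - \<theta>)"
      using x by (simp add: power2_eq_square)
    also have "\<dots> \<le> (1 / norm x)\<^sup>2 + (norm (x - \<theta>))\<^sup>2"
    proof -
      have "2 * (1 / norm x) * norm (x - \<theta>) \<le> (1 / norm x)\<^sup>2 + (norm (x - \<theta>))\<^sup>2"
        by (rule sum_squares_bound)
      moreover have "0 \<le> 1 / norm x * norm (x - \<theta>)" by simp
      ultimately show ?thesis by linarith
    qed
    finally have *: "\<bar>shrink r x * (x \<bullet> (x - \<theta>))\<bar> \<le> 1 / (norm x)\<^sup>2 + (norm (x - \<theta>))\<^sup>2"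
      by (simp add: power_divide)
    have p0: "0 \<le> p (x - \<theta>)" using p x by (auto simp: radial_kernel_def)
    have "norm (p (x - \<theta>) * (shrink r x * (x \<bullet> (x - \<theta>))))
        \<le> p (x - \<theta>) * (1 / (norm x)\<^sup>2 + (norm (x - \<theta>))\<^sup>2)"
      unfolding norm_mult[of "p (x - \<theta>)"] using * p0 by (intro mult_mono) auto
    also have "\<dots> = p (x - \<theta>) / (norm x)\<^sup>2 + p (x - \<theta>) * (norm (x - \<theta>))\<^sup>2"
      by (simp add: distrib_left)
    finally show "norm (p (x - \<theta>) * (shrink r x * (x \<bullet> (x - \<theta>))))
      \<le> norm (p (x - \<theta>) / (norm x)\<^sup>2 + p (x - \<theta>) * (norm (x - \<theta>))\<^sup>2)"
      by simp
  qed
qed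

lemma integral_shrink_shift_antimono:
  assumes p: "radial_kernel p" and r: "shrinkage r" and c: "0 \<le> c" "c \<le> c'"
  shows "(\<integral>x. p (x - c' *\<^sub>R \<theta>) * shrink r x \<partial>lborel) \<le> (\<integral>x. p (x - c *\<^sub>R \<theta>) * shrink r x \<partial>lborel)"
proof -
  have int: "integrable lborel (\<lambda>x. p (x - e *\<^sub>R \<theta>) * shrink r x)" for e
    by (rule integrable_kernel_shrink[OF p r])
  have nonneg: "AE x in lborel. 0 \<le> p (x - e *\<^sub>R \<theta>) * shrink r x" for e
    using AE_shift_nonzero[of "e *\<^sub>R \<theta>"]
    by eventually_elim (auto intro!: mult_nonneg_nonneg radial_kernel_nonneg[OF p] shrink_nonneg[OF r])
  have "ennreal (\<integral>x. p (x - c' *\<^sub>R \<theta>) * shrink r x \<partial>lborel)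
      \<le> ennreal (\<integral>x. p (x - c *\<^sub>R \<theta>) * shrink r x \<partial>lborel)"
    using nn_integral_kernel_shift_antimono[OF p borel_measurable_shrink[OF r]
        radially_decreasing_shrink[OF r] c shrink_nonneg[OF r], of \<theta>]
    by (simp add: nn_integral_eq_integral[OF int nonneg])
  then show ?thesis
    by (subst (asm) ennreal_le_iff) (intro integral_nonneg_AE nonneg)
qed

lemma radial_kernel_gauss:
  assumes \<kappa>: "0 < \<kappa>" and dim: "3 \<le> DIM('a::euclidean_space)"
  shows "radial_kernel (gauss \<kappa> :: 'a \<Rightarrow> real)"
proof -
  have "integrable lborel (\<lambda>x :: 'a. gauss \<kappa> x * (norm x)\<^sup>2)"
  proof (rule Bochner_Integration.integrable_bound)
    show "integrable lborel (\<lambda>x :: 'a. (2 / \<kappa>) * gauss (\<kappa> / 2) x)"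
      using \<kappa> by (intro integrable_mult_right integrable_gauss) simp
    have "gauss \<kappa> x * (norm x)\<^sup>2 \<le> (2 / \<kappa>) * gauss (\<kappa> / 2) x" for x :: 'a
    proof -
      have "\<kappa> / 2 * (norm x)\<^sup>2 \<le> exp (\<kappa> / 2 * (norm x)\<^sup>2)"
        using exp_ge_add_one_self[of "\<kappa> / 2 * (norm x)\<^sup>2"] by linarith
      then have "gauss \<kappa> x * (\<kappa> / 2 * (norm x)\<^sup>2) \<le> gauss \<kappa> x * exp (\<kappa> / 2 * (norm x)\<^sup>2)"
        by (intro mult_left_mono) auto
      also have "\<dots> = gauss (\<kappa> / 2) x"
        by (simp add: gauss_def exp_add[symmetric])
      finally show ?thesis using \<kappa> by (simp add: field_simps)
    qed
    then show "AE x :: 'a in lborel. norm (gauss \<kappa> x * (norm x)\<^sup>2) \<le> norm ((2 / \<kappa>) * gauss (\<kappa> / 2) x)"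
      using \<kappa> by (auto simp: abs_mult)
  qed measurable
  moreover have "radially_decreasing (gauss \<kappa> :: 'a \<Rightarrow> real)"
    using \<kappa> by (auto simp: radially_decreasing_def gauss_def)
  ultimately show ?thesis
    using assms by (simp add: radial_kernel_def integrable_gauss integrable_gauss_inverse)
qed

lemma power_split_square: "2 \<le> n \<Longrightarrow> c ^ n = c ^ (n - 2) * (c :: real)\<^sup>2"
  by (metis le_add_diff_inverse2 power_add)

section \<open>The shrinkage inequality for Gaussian kernels\<close>

text \<open>Substituting \<open>c *\<^sub>R x\<close> for \<open>x\<close> in the right-hand integral and using that \<open>r\<close> increases. This dilation bound is what
replaces differentiation of \<open>r\<close>.\<close>

lemma gauss_shrink_scaling:
  fixes \<theta> :: "'a::euclidean_space"
  assumes dim: "3 \<le> DIM('a)" and r: "shrinkage r" and \<kappa>: "0 < \<kappa>" and c: "1 \<le> c"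
  shows "integrable lborel (\<lambda>x. gauss \<kappa> (c *\<^sub>R x - \<theta>) * shrink r x)"
    and "c ^ (DIM('a) - 2) * (\<integral>x. gauss \<kappa> (c *\<^sub>R x - \<theta>) * shrink r x \<partial>lborel)
      \<le> (\<integral>x. gauss \<kappa> (x - \<theta>) * shrink r x \<partial>lborel)"
proof -
  define G where "G x = gauss \<kappa> (x - \<theta>) * shrink r x" for x
  have [measurable]: "shrink r \<in> borel_measurable (borel :: 'a measure)"
    using r by (rule borel_measurable_shrink)
  have G: "integrable lborel G"
    unfolding G_def by (rule integrable_kernel_shrink[OF radial_kernel_gauss[OF \<kappa> dim] r])
  have Gc: "integrable lborel (\<lambda>x. c\<^sup>2 * G (c *\<^sub>R x))"
    using integrable_lborel_affine[OF G, of c 0] c by simp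
  have le: "gauss \<kappa> (c *\<^sub>R x - \<theta>) * shrink r x \<le> c\<^sup>2 * G (c *\<^sub>R x)" for x
    using mult_left_mono[OF shrink_scaleR_ge[OF r c, of x], of "gauss \<kappa> (c *\<^sub>R x - \<theta>)"]
    by (simp add: G_def mult_ac)
  show int: "integrable lborel (\<lambda>x. gauss \<kappa> (c *\<^sub>R x - \<theta>) * shrink r x)"
  proof (rule Bochner_Integration.integrable_bound[OF Gc])
    show "AE x in lborel. norm (gauss \<kappa> (c *\<^sub>R x - \<theta>) * shrink r x) \<le> norm (c\<^sup>2 * G (c *\<^sub>R x))"
    proof (rule AE_I2)
      fix x
      show "norm (gauss \<kappa> (c *\<^sub>R x - \<theta>) * shrink r x) \<le> norm (c\<^sup>2 * G (c *\<^sub>R x))"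
        using le[of x] shrink_nonneg[OF r, of x] shrink_nonneg[OF r, of "c *\<^sub>R x"]
        by (simp add: abs_mult G_def)
    qed
  qed measurable
  have "c ^ DIM('a) = c ^ (DIM('a) - 2) * c\<^sup>2"
    using dim by (intro power_split_square) simp
  then have "(\<integral>x. G x \<partial>lborel) = c ^ (DIM('a) - 2) * (\<integral>x. c\<^sup>2 * G (c *\<^sub>R x) \<partial>lborel)"
    using integral_lborel_affine[of G c 0] G c by simp
  moreover have "(\<integral>x. gauss \<kappa> (c *\<^sub>R x - \<theta>) * shrink r x \<partial>lborel) \<le> (\<integral>x. c\<^sup>2 * G (c *\<^sub>R x) \<partial>lborel)"
    by (intro integral_mono int Gc le)
  ultimately have "c ^ (DIM('a) - 2) * (\<integral>x. gauss \<kappa> (c *\<^sub>R x - \<theta>) * shrink r x \<partial>lborel) \<le> (\<integral>x. G x \<partial>lborel)"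
    using c by (simp add: mult_left_mono)
  then show "c ^ (DIM('a) - 2) * (\<integral>x. gauss \<kappa> (c *\<^sub>R x - \<theta>) * shrink r x \<partial>lborel)
      \<le> (\<integral>x. gauss \<kappa> (x - \<theta>) * shrink r x \<partial>lborel)"
    by (simp add: G_def)
qed

text \<open>An inequality form of Stein's identity for the radial field \<open>r (|x|\<^sup>2) x / |x|\<^sup>2\<close>, whose divergence is at least
\<open>(d - 2) r (|x|\<^sup>2) / |x|\<^sup>2\<close>. The derivative is taken along dilations instead of by partial integration: compare
\<open>F 1\<close> with \<open>F (1 + e)\<close>, where \<open>F s\<close> is the integral with \<open>x\<close> dilated by \<open>s\<close> inside the kernel. The scaling lemma bounds
\<open>F (1 + e)\<close> from above, convexity of \<open>exp\<close> bounds the difference, and \<open>e \<rightarrow> 0\<close> gives the claim.\<close>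

lemma gauss_stein:
  fixes \<theta> :: "'a::euclidean_space"
  assumes dim: "3 \<le> DIM('a)" and r: "shrinkage r" and \<kappa>: "0 < \<kappa>"
  shows "real (DIM('a) - 2) * (\<integral>x. gauss \<kappa> (x - \<theta>) * shrink r x \<partial>lborel)
    \<le> 2 * \<kappa> * (\<integral>x. gauss \<kappa> (x - \<theta>) * (shrink r x * (x \<bullet> (x - \<theta>))) \<partial>lborel)"
    (is "real ?k * ?K \<le> 2 * \<kappa> * ?S")
proof -
  define N where "N = (\<integral>x. gauss \<kappa> (x - \<theta>) \<partial>lborel)"
  define F where "F s = (\<integral>x. gauss \<kappa> (s *\<^sub>R x - \<theta>) * shrink r x \<partial>lborel)" for s
  note kernel = radial_kernel_gauss[OF \<kappa> dim]
  have intN: "integrable lborel (\<lambda>x. gauss \<kappa> (x - \<theta>))"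
    by (intro integrable_lborel_shift integrable_gauss \<kappa>)
  have bound: "real ?k * ?K \<le> (1 + e) ^ ?k * (\<kappa> * (2 * ?S + e * N))" if e: "0 < e" for e
  proof -
    let ?s = "1 + e"
    have "?K - F ?s = (\<integral>x. gauss \<kappa> (x - \<theta>) * shrink r x - gauss \<kappa> (?s *\<^sub>R x - \<theta>) * shrink r x \<partial>lborel)"
      unfolding F_def using e
      by (intro Bochner_Integration.integral_diff[symmetric] integrable_kernel_shrink[OF kernel r]
          gauss_shrink_scaling[OF dim r \<kappa>]) simp
    also have "\<dots> \<le> (\<integral>x. \<kappa> * e * (2 * (gauss \<kappa> (x - \<theta>) * (shrink r x * (x \<bullet> (x - \<theta>)))) + e * gauss \<kappa> (x - \<theta>)) \<partial>lborel)"
    proof (intro integral_mono)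
      fix x
      \<comment> \<open>\<open>\<Delta>\<close> is the increase of the exponent under the dilation; \<open>1 - exp (- \<Delta>) \<le> \<Delta>\<close>.\<close>
      have sq: "(norm (?s *\<^sub>R x - \<theta>))\<^sup>2 - (norm (x - \<theta>))\<^sup>2 = e * (2 * (x \<bullet> (x - \<theta>)) + e * (norm x)\<^sup>2)"
        unfolding power2_norm_eq_inner
        by (simp add: inner_diff_left inner_diff_right inner_add_left inner_add_right inner_commute algebra_simps)
      define \<Delta> where "\<Delta> = \<kappa> * e * (2 * (x \<bullet> (x - \<theta>)) + e * (norm x)\<^sup>2)"
      have "- \<kappa> * (norm (?s *\<^sub>R x - \<theta>))\<^sup>2 = - \<kappa> * (norm (x - \<theta>))\<^sup>2 + - \<Delta>"
        unfolding diff_eq_eq[THEN iffD1, OF sq] \<Delta>_def by (simp add: algebra_simps)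
      then have "gauss \<kappa> (?s *\<^sub>R x - \<theta>) = gauss \<kappa> (x - \<theta>) * exp (- \<Delta>)"
        unfolding gauss_def by (metis exp_add)
      then have "gauss \<kappa> (x - \<theta>) - gauss \<kappa> (?s *\<^sub>R x - \<theta>) = gauss \<kappa> (x - \<theta>) * (1 - exp (- \<Delta>))"
        by (simp add: algebra_simps)
      also have "\<dots> \<le> gauss \<kappa> (x - \<theta>) * \<Delta>"
        using exp_ge_add_one_self[of "- \<Delta>"] by (intro mult_left_mono) auto
      finally have "(gauss \<kappa> (x - \<theta>) - gauss \<kappa> (?s *\<^sub>R x - \<theta>)) * shrink r x \<le> gauss \<kappa> (x - \<theta>) * \<Delta> * shrink r x"
        by (rule mult_right_mono) (rule shrink_nonneg[OF r])
      also have "\<dots> = \<kappa> * e * (2 * (gauss \<kappa> (x - \<theta>) * (shrink r x * (x \<bullet> (x - \<theta>))))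
          + e * (gauss \<kappa> (x - \<theta>) * ((norm x)\<^sup>2 * shrink r x)))"
        by (simp add: \<Delta>_def algebra_simps)
      also have "\<dots> \<le> \<kappa> * e * (2 * (gauss \<kappa> (x - \<theta>) * (shrink r x * (x \<bullet> (x - \<theta>))))
          + e * (gauss \<kappa> (x - \<theta>) * 1))"
        using norm_power2_shrink_le[OF r, of x] e \<kappa> by (intro mult_left_mono add_left_mono) auto
      finally show "gauss \<kappa> (x - \<theta>) * shrink r x - gauss \<kappa> (?s *\<^sub>R x - \<theta>) * shrink r x
        \<le> \<kappa> * e * (2 * (gauss \<kappa> (x - \<theta>) * (shrink r x * (x \<bullet> (x - \<theta>)))) + e * gauss \<kappa> (x - \<theta>))"
        by (simp add: left_diff_distrib)
    qed (use e in \<open>auto intro!: integrable_kernel_shrink[OF kernel r] intN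
          integrable_kernel_shrink_inner[OF kernel r] gauss_shrink_scaling[OF dim r \<kappa>]\<close>)
    also have "\<dots> = \<kappa> * e * (2 * ?S + e * N)"
      using intN integrable_kernel_shrink_inner[OF kernel r, of \<theta>] by (simp add: N_def)
    finally have diff: "?K - F ?s \<le> e * (\<kappa> * (2 * ?S + e * N))"
      by (simp add: mult_ac)
    have "0 \<le> ?K"
      by (intro integral_nonneg_AE AE_I2 mult_nonneg_nonneg shrink_nonneg[OF r]) simp
    \<comment> \<open>Bernoulli's inequality turns the factor \<open>?s ^ ?k\<close> of the scaling lemma into the constant \<open>d - 2\<close>.\<close>
    have "1 + real ?k * e \<le> ?s ^ ?k"
      using e by (intro Bernoulli_inequality) simp
    then have "e * (real ?k * ?K) \<le> (?s ^ ?k - 1) * ?K"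
      using mult_right_mono[OF _ \<open>0 \<le> ?K\<close>, of "1 + real ?k * e" "?s ^ ?k"] by (simp add: algebra_simps)
    also have "\<dots> \<le> ?s ^ ?k * ?K - ?s ^ ?k * F ?s"
      using gauss_shrink_scaling(2)[OF dim r \<kappa>, of ?s \<theta>] e by (simp add: F_def algebra_simps)
    also have "\<dots> = ?s ^ ?k * (?K - F ?s)"
      by (simp add: algebra_simps)
    also have "\<dots> \<le> ?s ^ ?k * (e * (\<kappa> * (2 * ?S + e * N)))"
      using diff e by (intro mult_left_mono) auto
    also have "\<dots> = e * (?s ^ ?k * (\<kappa> * (2 * ?S + e * N)))"
      by simp
    finally show ?thesis
      using e by simp
  qed
  have "((\<lambda>e. (1 + e) ^ ?k * (\<kappa> * (2 * ?S + e * N))) \<longlongrightarrow> (1 + 0) ^ ?k * (\<kappa> * (2 * ?S + 0 * N))) (at_right 0)"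
    by (intro tendsto_intros)
  then have "real ?k * ?K \<le> (1 + 0) ^ ?k * (\<kappa> * (2 * ?S + 0 * N))"
    by (rule tendsto_lowerbound) (auto intro!: eventually_at_right_less[THEN eventually_mono] bound)
  then show ?thesis
    by simp
qed

text \<open>In probabilistic terms: for \<open>X\<close> normal with mean \<open>\<theta>\<close> and variance \<open>v\<close>, \<open>v * E (r (|X|\<^sup>2) / |X|\<^sup>2)\<close> increases with
\<open>v\<close>. After rescaling to unit variance there are two effects of the same sign: \<open>r\<close> is evaluated at a larger argument, and
the rescaled mean \<open>\<theta> / sqrt v\<close> moves towards the origin.\<close>

lemma gauss_shrink_rate_antimono:
  fixes \<theta> :: "'a::euclidean_space"
  assumes dim: "3 \<le> DIM('a)" and r: "shrinkage r" and \<kappa>: "0 < \<kappa>" "\<kappa> \<le> \<mu>"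
  shows "\<kappa> * (\<integral>(x::'a). gauss \<kappa> x \<partial>lborel) * (\<integral>x. gauss \<mu> (x - \<theta>) * shrink r x \<partial>lborel)
    \<le> \<mu> * (\<integral>(x::'a). gauss \<mu> x \<partial>lborel) * (\<integral>x. gauss \<kappa> (x - \<theta>) * shrink r x \<partial>lborel)"
    (is "\<kappa> * ?N * ?K' \<le> \<mu> * ?N' * ?K")
proof -
  \<comment> \<open>Dilation by \<open>c\<close> carries the rate \<open>\<kappa>\<close> to the rate \<open>\<mu>\<close>.\<close>
  define c where "c = sqrt (\<mu> / \<kappa>)"
  have c: "1 \<le> c" and c2: "\<mu> = \<kappa> * c\<^sup>2"
    using \<kappa> by (auto simp: c_def)
  have gauss_c: "gauss \<kappa> (c *\<^sub>R x) = gauss \<mu> x" for x :: 'a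
    by (simp add: gauss_def c2 power_mult_distrib)
  have N: "?N = c ^ DIM('a) * ?N'"
    using integral_lborel_affine[of "gauss \<kappa> :: 'a \<Rightarrow> real" c 0] c by (simp add: gauss_c)
  have "?K' \<le> (\<integral>x. gauss \<mu> (x - (1 / c) *\<^sub>R \<theta>) * shrink r x \<partial>lborel)"
    using integral_shrink_shift_antimono[OF radial_kernel_gauss[OF _ dim] r, of \<mu> "1 / c" 1 \<theta>] \<kappa> c by simp
  also have "\<dots> = (\<integral>x. gauss \<kappa> (c *\<^sub>R x - \<theta>) * shrink r x \<partial>lborel)"
    using c by (simp add: gauss_c[symmetric] scaleR_diff_right)
  finally have "c ^ (DIM('a) - 2) * ?K' \<le> ?K"
    using gauss_shrink_scaling(2)[OF dim r \<kappa>(1) c, of \<theta>] c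
    by (meson mult_left_mono order_trans zero_le_power zero_le_one)
  moreover have "0 \<le> \<mu> * ?N'"
    using \<kappa> by (intro mult_nonneg_nonneg integral_nonneg_AE) auto
  ultimately have "\<mu> * ?N' * (c ^ (DIM('a) - 2) * ?K') \<le> \<mu> * ?N' * ?K"
    by (rule mult_left_mono)
  moreover have "c ^ DIM('a) = c ^ (DIM('a) - 2) * c\<^sup>2"
    using dim by (intro power_split_square) simp
  then have "\<mu> * ?N' * (c ^ (DIM('a) - 2) * ?K') = \<kappa> * ?N * ?K'"
    unfolding N c2 by simp
  ultimately show ?thesis
    by simp
qed

text \<open>With \<open>G = K / (\<kappa> N)\<close> the two previous lemmas and \<open>I = 2 \<kappa> N / (d - 2)\<close> leave a multiple of
\<open>(\<kappa> - \<mu>) (G \<mu> - G \<kappa>) \<ge> 0\<close>, which holds because \<open>G\<close> decreases. The statement is symmetric and bilinear in the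
two kernels so that it survives integration over both rates.\<close>

lemma gauss_pair_inequality:
  fixes \<theta> :: "'a::euclidean_space"
  assumes dim: "3 \<le> DIM('a)" and r: "shrinkage r" and pos: "0 < \<kappa>" "0 < \<mu>"
  defines "N \<equiv> \<lambda>\<kappa>. \<integral>(x::'a). gauss \<kappa> x \<partial>lborel"
    and "I \<equiv> \<lambda>\<kappa>. \<integral>(x::'a). gauss \<kappa> x / (norm x)\<^sup>2 \<partial>lborel"
    and "K \<equiv> \<lambda>\<kappa>. \<integral>x. gauss \<kappa> (x - \<theta>) * shrink r x \<partial>lborel"
    and "S \<equiv> \<lambda>\<kappa>. \<integral>x. gauss \<kappa> (x - \<theta>) * (shrink r x * (x \<bullet> (x - \<theta>))) \<partial>lborel"
  shows "N \<kappa> * K \<mu> + N \<mu> * K \<kappa> \<le> I \<kappa> * S \<mu> + I \<mu> * S \<kappa>"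
proof -
  have N0: "0 < N \<kappa>" if "0 < \<kappa>" for \<kappa>
    unfolding N_def integral_gauss[OF that] using that by simp
  have IS: "N \<kappa> * K \<mu> * (\<kappa> / \<mu>) \<le> I \<kappa> * S \<mu>" if "0 < \<kappa>" "0 < \<mu>" for \<kappa> \<mu>
  proof -
    define k where "k = real (DIM('a) - 2)"
    have k: "0 < k" using dim by (simp add: k_def)
    have "I \<kappa> = 2 * \<kappa> / k * N \<kappa>"
      unfolding I_def N_def k_def by (rule integral_gauss_inverse[OF that(1) dim])
    moreover have "k * K \<mu> \<le> 2 * \<mu> * S \<mu>"
      unfolding k_def K_def S_def by (rule gauss_stein[OF dim r that(2)])
    then have "2 * \<kappa> / k * N \<kappa> * (k * K \<mu> / (2 * \<mu>)) \<le> 2 * \<kappa> / k * N \<kappa> * S \<mu>"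
      using that k N0[OF that(1)] by (intro mult_left_mono) (auto simp: divide_simps mult_ac)
    ultimately show ?thesis
      using k that by (simp add: mult_ac)
  qed
  have main: "N \<kappa> * K \<mu> + N \<mu> * K \<kappa> \<le> I \<kappa> * S \<mu> + I \<mu> * S \<kappa>"
    if "0 < \<kappa>" "\<kappa> \<le> \<mu>" for \<kappa> \<mu>
  proof -
    have \<mu>: "0 < \<mu>" using that by simp
    have "\<kappa> * N \<kappa> * K \<mu> \<le> \<mu> * N \<mu> * K \<kappa>"
      unfolding N_def K_def by (rule gauss_shrink_rate_antimono[OF dim r that])
    then have "0 \<le> (\<mu> - \<kappa>) / (\<mu> * \<kappa>) * (\<mu> * N \<mu> * K \<kappa> - \<kappa> * N \<kappa> * K \<mu>)"
      using that by (intro mult_nonneg_nonneg) auto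
    also have "\<dots> = N \<kappa> * K \<mu> * (\<kappa> / \<mu>) + N \<mu> * K \<kappa> * (\<mu> / \<kappa>) - (N \<kappa> * K \<mu> + N \<mu> * K \<kappa>)"
      using that \<mu> by (simp add: field_simps)
    finally show ?thesis
      using IS[OF that(1) \<mu>] IS[OF \<mu> that(1)] by linarith
  qed
  show ?thesis
  proof (cases "\<kappa> \<le> \<mu>")
    case True
    then show ?thesis using main[OF pos(1)] by simp
  next
    case False
    then show ?thesis using main[OF pos(2), of \<kappa>] by simp
  qed
qed

section \<open>Mixtures and limits\<close>

text \<open>The inequality \<open>N K \<le> I S\<close> on which the dominance rests.\<close>

definition shrinkage_inequality :: "(real \<Rightarrow> real) \<Rightarrow> 'a::euclidean_space \<Rightarrow> ('a \<Rightarrow> real) \<Rightarrow> bool" where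
  "shrinkage_inequality r \<theta> p \<longleftrightarrow>
     (\<integral>x. p x \<partial>lborel) * (\<integral>x. p (x - \<theta>) * shrink r x \<partial>lborel)
     \<le> (\<integral>x. p x / (norm x)\<^sup>2 \<partial>lborel) * (\<integral>x. p (x - \<theta>) * (shrink r x * (x \<bullet> (x - \<theta>))) \<partial>lborel)"

text \<open>Fubini, with integrability on the product supplied by integrability against the mixed kernel.\<close>

lemma
  fixes p :: "'a::euclidean_space \<Rightarrow> real" and \<phi> :: "'a \<Rightarrow> real"
  assumes Q: "sigma_finite_measure Q" and [measurable]: "\<kappa> \<in> borel_measurable Q" "\<phi> \<in> borel_measurable borel"
    and p0: "\<And>x. x \<noteq> 0 \<Longrightarrow> 0 \<le> p x"
    and p: "\<And>x. x \<noteq> 0 \<Longrightarrow> ennreal (p x) = (\<integral>\<^sup>+v. ennreal (gauss (\<kappa> v) x) \<partial>Q)"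
    and int: "integrable lborel (\<lambda>x. p (x - \<theta>) * \<phi> x)"
  shows integrable_gauss_mixture: "integrable Q (\<lambda>v. \<integral>x. gauss (\<kappa> v) (x - \<theta>) * \<phi> x \<partial>lborel)" (is ?int)
    and integral_gauss_mixture: "(\<integral>v. (\<integral>x. gauss (\<kappa> v) (x - \<theta>) * \<phi> x \<partial>lborel) \<partial>Q)
      = (\<integral>x. p (x - \<theta>) * \<phi> x \<partial>lborel)" (is ?eq)
proof -
  interpret Q: sigma_finite_measure Q by fact
  interpret pair_sigma_finite "lborel :: 'a measure" Q ..
  define F where "F x v = gauss (\<kappa> v) (x - \<theta>) * \<phi> x" for x v
  have F_meas: "case_prod F \<in> borel_measurable (lborel \<Otimes>\<^sub>M Q)"
    unfolding F_def gauss_def by measurable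
  have nn: "ennreal (p (x - \<theta>)) = (\<integral>\<^sup>+v. ennreal (gauss (\<kappa> v) (x - \<theta>)) \<partial>Q)" if "x - \<theta> \<noteq> 0" for x
    using p[OF that] .
  have meas: "(\<lambda>v. gauss (\<kappa> v) x) \<in> borel_measurable Q" for x :: 'a
    unfolding gauss_def by measurable
  have int_v: "integrable Q (\<lambda>v. gauss (\<kappa> v) (x - \<theta>))" if "x - \<theta> \<noteq> 0" for x
    using nn[OF that] by (intro integrableI_nonneg meas) (auto simp: less_top[symmetric] simp flip: nn[OF that])
  have eq_v: "(\<integral>v. gauss (\<kappa> v) (x - \<theta>) \<partial>Q) = p (x - \<theta>)" if "x - \<theta> \<noteq> 0" for x
    using p0[OF that] by (subst integral_eq_nn_integral) (auto intro: meas simp flip: nn[OF that])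
  have pair: "integrable (lborel \<Otimes>\<^sub>M Q) (case_prod F)"
  proof (rule Fubini_integrable[OF F_meas])
    have "integrable lborel (\<lambda>x. norm (p (x - \<theta>) * \<phi> x))"
      using int by (rule integrable_norm)
    moreover have "AE x in lborel. (\<integral>v. norm (case_prod F (x, v)) \<partial>Q) = norm (p (x - \<theta>) * \<phi> x)"
      using AE_shift_nonzero[of \<theta>]
      by eventually_elim (simp add: F_def abs_mult eq_v p0)
    ultimately show "integrable lborel (\<lambda>x. \<integral>v. norm (case_prod F (x, v)) \<partial>Q)"
      using F_meas by (subst integrable_cong_AE[where g = "\<lambda>x. norm (p (x - \<theta>) * \<phi> x)"])
        (auto intro!: Q.borel_measurable_lebesgue_integral borel_measurable_integrable[of lborel "\<lambda>x. \<bar>p (x - \<theta>) * \<phi> x\<bar>"])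
    show "AE x in lborel. integrable Q (\<lambda>v. case_prod F (x, v))"
      using AE_shift_nonzero[of \<theta>] by eventually_elim (auto simp: F_def intro!: integrable_mult_left int_v)
  qed
  show ?int
    using integrable_snd[OF pair] by (simp add: F_def)
  have "(\<integral>v. (\<integral>x. F x v \<partial>lborel) \<partial>Q) = (\<integral>x. (\<integral>v. F x v \<partial>Q) \<partial>lborel)"
    using Fubini_integral[OF pair] by simp
  also have "\<dots> = (\<integral>x. p (x - \<theta>) * \<phi> x \<partial>lborel)"
  proof (rule integral_cong_AE)
    show "(\<lambda>x. \<integral>v. F x v \<partial>Q) \<in> borel_measurable lborel"
      by (rule Q.borel_measurable_lebesgue_integral[OF F_meas])
    show "AE x in lborel. (\<integral>v. F x v \<partial>Q) = p (x - \<theta>) * \<phi> x"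
      using AE_shift_nonzero[of \<theta>] by eventually_elim (simp add: F_def eq_v)
  qed (use int in auto)
  finally show ?eq
    by (simp add: F_def)
qed

text \<open>Chebyshev's association inequality in bilinear form: integrating the pointwise hypothesis in both variables gives
twice the conclusion.\<close>

lemma bilinear_integral_inequality:
  fixes N K I S :: "'v \<Rightarrow> real"
  assumes int: "integrable Q N" "integrable Q K" "integrable Q I" "integrable Q S"
    and le: "\<And>v w. v \<in> space Q \<Longrightarrow> w \<in> space Q \<Longrightarrow> N v * K w + N w * K v \<le> I v * S w + I w * S v"
  shows "(\<integral>v. N v \<partial>Q) * (\<integral>v. K v \<partial>Q) \<le> (\<integral>v. I v \<partial>Q) * (\<integral>v. S v \<partial>Q)"
proof -
  let ?n = "\<integral>v. N v \<partial>Q" and ?k = "\<integral>v. K v \<partial>Q" and ?i = "\<integral>v. I v \<partial>Q" and ?s = "\<integral>v. S v \<partial>Q"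
  have "?n * K w + N w * ?k \<le> ?i * S w + I w * ?s" if "w \<in> space Q" for w
  proof -
    have "(\<integral>v. N v * K w + N w * K v \<partial>Q) \<le> (\<integral>v. I v * S w + I w * S v \<partial>Q)"
      using that by (intro integral_mono le) (auto intro!: int integrable_mult_left integrable_mult_right)
    then show ?thesis
      using int by simp
  qed
  then have "(\<integral>w. ?n * K w + N w * ?k \<partial>Q) \<le> (\<integral>w. ?i * S w + I w * ?s \<partial>Q)"
    by (intro integral_mono) (auto intro!: int integrable_mult_left integrable_mult_right)
  then show ?thesis
    using int by (simp add: mult.commute)
qed

lemma shrinkage_inequality_gauss_mixture:
  fixes p :: "'a::euclidean_space \<Rightarrow> real"
  assumes dim: "3 \<le> DIM('a)" and r: "shrinkage r" and p: "radial_kernel p"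
    and Q: "sigma_finite_measure Q" and [measurable]: "\<kappa> \<in> borel_measurable Q"
    and \<kappa>: "\<And>v. 0 < \<kappa> v"
    and mix: "\<And>x. x \<noteq> 0 \<Longrightarrow> ennreal (p x) = (\<integral>\<^sup>+v. ennreal (gauss (\<kappa> v) x) \<partial>Q)"
  shows "shrinkage_inequality r \<theta> p"
proof -
  note mixture = integrable_gauss_mixture[OF Q _ _ radial_kernel_nonneg[OF p] mix]
    integral_gauss_mixture[OF Q _ _ radial_kernel_nonneg[OF p] mix]
  have [measurable]: "shrink r \<in> borel_measurable (borel :: 'a measure)"
    using r by (rule borel_measurable_shrink)
  have int: "integrable lborel (\<lambda>x. p (x - 0) * 1)" "integrable lborel (\<lambda>x. p (x - 0) * (1 / (norm x)\<^sup>2))"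
    using p by (auto simp: radial_kernel_def)
  show ?thesis
    unfolding shrinkage_inequality_def
    using bilinear_integral_inequality[OF
        mixture(1)[OF _ _ _ _ int(1)] mixture(1)[OF _ _ _ _ integrable_kernel_shrink[OF p r, of \<theta>]]
        mixture(1)[OF _ _ _ _ int(2)] mixture(1)[OF _ _ _ _ integrable_kernel_shrink_inner[OF p r, of \<theta>]]]
      mixture(2)[OF _ _ _ _ int(1)] mixture(2)[OF _ _ _ _ integrable_kernel_shrink[OF p r, of \<theta>]]
      mixture(2)[OF _ _ _ _ int(2)] mixture(2)[OF _ _ _ _ integrable_kernel_shrink_inner[OF p r, of \<theta>]]
      gauss_pair_inequality[OF dim r \<kappa> \<kappa>, where \<theta> = \<theta>]
    by simp
qed

text \<open>All four integrals are continuous under domination by a radial kernel.\<close>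

lemma shrinkage_inequality_limit:
  fixes p P :: "'a::euclidean_space \<Rightarrow> real" and q :: "nat \<Rightarrow> 'a \<Rightarrow> real"
  assumes r: "shrinkage r" and P: "radial_kernel P"
    and [measurable]: "p \<in> borel_measurable borel" "\<And>n. q n \<in> borel_measurable borel"
    and bound: "\<And>n x. x \<noteq> 0 \<Longrightarrow> 0 \<le> q n x \<and> q n x \<le> P x"
    and lim: "\<And>x. x \<noteq> 0 \<Longrightarrow> (\<lambda>n. q n x) \<longlonglongrightarrow> p x"
    and ineq: "\<And>n. shrinkage_inequality r \<theta> (q n)"
  shows "shrinkage_inequality r \<theta> p"
proof -
  have [measurable]: "P \<in> borel_measurable borel" "shrink r \<in> borel_measurable (borel :: 'a measure)"
    using P r by (auto intro: radial_kernel_measurable borel_measurable_shrink)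
  have conv: "(\<lambda>n. \<integral>x. q n (x - \<eta>) * \<phi> x \<partial>lborel) \<longlonglongrightarrow> (\<integral>x. p (x - \<eta>) * \<phi> x \<partial>lborel)"
    if [measurable]: "\<phi> \<in> borel_measurable borel" and int: "integrable lborel (\<lambda>x. P (x - \<eta>) * \<phi> x)"
    for \<phi> :: "'a \<Rightarrow> real" and \<eta>
  proof (rule integral_dominated_convergence)
    show "integrable lborel (\<lambda>x. norm (P (x - \<eta>) * \<phi> x))"
      using int by (rule integrable_norm)
    show "AE x in lborel. (\<lambda>n. q n (x - \<eta>) * \<phi> x) \<longlonglongrightarrow> p (x - \<eta>) * \<phi> x"
      using AE_shift_nonzero[of \<eta>] by eventually_elim (intro tendsto_mult_right lim, simp)
    show "AE x in lborel. norm (q n (x - \<eta>) * \<phi> x) \<le> norm (P (x - \<eta>) * \<phi> x)" for n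
      using AE_shift_nonzero[of \<eta>]
    proof eventually_elim
      fix x assume "x \<noteq> 0 \<and> x - \<eta> \<noteq> 0"
      then have "\<bar>q n (x - \<eta>)\<bar> \<le> \<bar>P (x - \<eta>)\<bar>"
        using bound[of "x - \<eta>" n] by auto
      then show "norm (q n (x - \<eta>) * \<phi> x) \<le> norm (P (x - \<eta>) * \<phi> x)"
        by (simp add: abs_mult mult_right_mono)
    qed
  qed measurable
  have int: "integrable lborel (\<lambda>x. P (x - 0) * 1)" "integrable lborel (\<lambda>x. P (x - 0) * (1 / (norm x)\<^sup>2))"
    using P by (auto simp: radial_kernel_def)
  note convs = conv[OF _ int(1)] conv[OF _ int(2)] conv[OF _ integrable_kernel_shrink[OF P r, of \<theta>]]
    conv[OF _ integrable_kernel_shrink_inner[OF P r, of \<theta>]]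
  show ?thesis
    unfolding shrinkage_inequality_def
  proof (rule LIMSEQ_le)
    show "(\<lambda>n. (\<integral>x. q n x \<partial>lborel) * (\<integral>x. q n (x - \<theta>) * shrink r x \<partial>lborel))
      \<longlonglongrightarrow> (\<integral>x. p x \<partial>lborel) * (\<integral>x. p (x - \<theta>) * shrink r x \<partial>lborel)"
      using convs by (intro tendsto_mult) auto
    show "(\<lambda>n. (\<integral>x. q n x / (norm x)\<^sup>2 \<partial>lborel) * (\<integral>x. q n (x - \<theta>) * (shrink r x * (x \<bullet> (x - \<theta>))) \<partial>lborel))
      \<longlonglongrightarrow> (\<integral>x. p x / (norm x)\<^sup>2 \<partial>lborel) * (\<integral>x. p (x - \<theta>) * (shrink r x * (x \<bullet> (x - \<theta>))) \<partial>lborel)"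
      using convs by (intro tendsto_mult) auto
  qed (use ineq in \<open>auto simp: shrinkage_inequality_def\<close>)
qed

section \<open>Taylor series of completely monotone functions\<close>

text \<open>The intended \<open>b k\<close> is the \<open>k\<close>-th derivative of \<open>b 0\<close>.\<close>

definition taylor_remainder :: "(nat \<Rightarrow> real \<Rightarrow> real) \<Rightarrow> nat \<Rightarrow> nat \<Rightarrow> real \<Rightarrow> real" where
  "taylor_remainder b k K s = b k s - (\<Sum>j<K. b (k + j) 0 * s ^ j / fact j)"

lemma taylor_remainder_0 [simp]: "taylor_remainder b k 0 s = b k s"
  by (simp add: taylor_remainder_def)

lemma taylor_remainder_Suc_at_0 [simp]: "taylor_remainder b k (Suc K) 0 = 0"
  unfolding taylor_remainder_def sum.lessThan_Suc_shift by simp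

lemma DERIV_taylor_remainder:
  assumes "(b k has_real_derivative b (Suc k) s) (at s)"
  shows "(taylor_remainder b k (Suc K) has_real_derivative taylor_remainder b (Suc k) K s) (at s)"
proof -
  have eq: "taylor_remainder b k (Suc K) =
      (\<lambda>s. b k s - (b k 0 + (\<Sum>j<K. b (Suc k + j) 0 / fact (Suc j) * s ^ Suc j)))"
    unfolding taylor_remainder_def sum.lessThan_Suc_shift by (simp add: fun_eq_iff)
  have summand: "((\<lambda>s. b (Suc k + j) 0 / fact (Suc j) * s ^ Suc j) has_real_derivative
      b (Suc k + j) 0 * s ^ j / fact j) (at s)" for j
  proof -
    have "((\<lambda>s. b (Suc k + j) 0 / fact (Suc j) * s ^ Suc j) has_real_derivative
        b (Suc k + j) 0 / fact (Suc j) * (real (Suc j) * s ^ (Suc j - Suc 0))) (at s)"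
      by (intro DERIV_cmult DERIV_pow)
    moreover have "b (Suc k + j) 0 / fact (Suc j) * (real (Suc j) * s ^ (Suc j - Suc 0))
        = b (Suc k + j) 0 * s ^ j / fact j"
      by (simp add: divide_simps del: of_nat_Suc)
    ultimately show ?thesis
      by simp
  qed
  have "((\<lambda>s. \<Sum>j<K. b (Suc k + j) 0 / fact (Suc j) * s ^ Suc j) has_real_derivative
      (\<Sum>j<K. b (Suc k + j) 0 * s ^ j / fact j)) (at s)"
    by (intro DERIV_sum summand)
  from DERIV_diff[OF assms DERIV_add[OF DERIV_const this, of "b k 0"]] show ?thesis
    unfolding eq unfolding taylor_remainder_def by simp
qed

context
  fixes b :: "nat \<Rightarrow> real \<Rightarrow> real" and S :: real
  assumes deriv: "\<And>k s. 0 \<le> s \<Longrightarrow> s \<le> S \<Longrightarrow> (b k has_real_derivative b (Suc k) s) (at s)"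
    and nonneg: "\<And>k s. 0 \<le> s \<Longrightarrow> s \<le> S \<Longrightarrow> 0 \<le> b k s"
begin

lemma taylor_remainder_nonneg: "0 \<le> s \<Longrightarrow> s \<le> S \<Longrightarrow> 0 \<le> taylor_remainder b k K s"
proof (induction K arbitrary: k s)
  case (Suc K)
  have "taylor_remainder b k (Suc K) 0 \<le> taylor_remainder b k (Suc K) s"
  proof (rule DERIV_nonneg_imp_nondecreasing[where f = "taylor_remainder b k (Suc K)"])
    fix x assume "0 \<le> x" "x \<le> s"
    then show "\<exists>y. (taylor_remainder b k (Suc K) has_real_derivative y) (at x) \<and> 0 \<le> y"
      using Suc.prems by (intro exI[of _ "taylor_remainder b (Suc k) K x"] conjI
          DERIV_taylor_remainder deriv Suc.IH) auto
  qed (use Suc.prems in auto)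
  then show ?case by simp
qed (simp add: nonneg)

text \<open>If all derivatives are nonnegative, \<open>s \<mapsto> R\<^sub>K s / s ^ K\<close> is increasing for the \<open>K\<close>-th remainder \<open>R\<^sub>K\<close>: the
derivative in \<open>s\<close> of \<open>\<rho> ^ Suc K * R s - R (\<rho> * s)\<close> is \<open>\<rho>\<close> times the same expression for the next derivative and
order \<open>K\<close>, so induction on \<open>K\<close> applies.\<close>

lemma taylor_remainder_scale:
  "0 \<le> s \<Longrightarrow> s \<le> S \<Longrightarrow> 0 \<le> \<rho> \<Longrightarrow> \<rho> \<le> 1 \<Longrightarrow>
    taylor_remainder b k K (\<rho> * s) \<le> \<rho> ^ K * taylor_remainder b k K s"
proof (induction K arbitrary: k s)
  case 0
  have "b k (\<rho> * s) \<le> b k s"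
  proof (rule DERIV_nonneg_imp_nondecreasing[where f = "b k"])
    show "\<rho> * s \<le> s" using 0 by (simp add: mult_left_le_one_le)
    fix x assume "\<rho> * s \<le> x" and "x \<le> s"
    moreover have "0 \<le> \<rho> * s" using 0 by simp
    ultimately have "0 \<le> x" by linarith
    then show "\<exists>y. (b k has_real_derivative y) (at x) \<and> 0 \<le> y"
      using 0 \<open>x \<le> s\<close> by (intro exI[of _ "b (Suc k) x"] conjI deriv nonneg) auto
  qed
  then show ?case by simp
next
  case (Suc K)
  let ?D = "\<lambda>s. \<rho> ^ Suc K * taylor_remainder b k (Suc K) s - taylor_remainder b k (Suc K) (\<rho> * s)"
  have "?D 0 \<le> ?D s"
  proof (rule DERIV_nonneg_imp_nondecreasing[where f = ?D])
    fix x assume x: "0 \<le> x" "x \<le> s"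
    then have \<rho>x: "0 \<le> \<rho> * x" "\<rho> * x \<le> S"
      using Suc.prems mult_left_le_one_le[of x \<rho>] by simp_all
    have "(?D has_real_derivative \<rho> ^ Suc K * taylor_remainder b (Suc k) K x
        - taylor_remainder b (Suc k) K (\<rho> * x) * \<rho>) (at x)"
    proof (rule DERIV_diff[OF DERIV_cmult])
      show "(taylor_remainder b k (Suc K) has_real_derivative taylor_remainder b (Suc k) K x) (at x)"
        using x Suc.prems by (intro DERIV_taylor_remainder deriv) auto
      have "(taylor_remainder b k (Suc K) has_real_derivative
          taylor_remainder b (Suc k) K (\<rho> * x)) (at (\<rho> * x))"
        using \<rho>x by (intro DERIV_taylor_remainder deriv)
      then show "((\<lambda>x. taylor_remainder b k (Suc K) (\<rho> * x)) has_real_derivative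
          taylor_remainder b (Suc k) K (\<rho> * x) * \<rho>) (at x)"
        by (rule DERIV_chain2) (rule DERIV_cmult_Id)
    qed
    moreover have "\<rho> * taylor_remainder b (Suc k) K (\<rho> * x)
        \<le> \<rho> * (\<rho> ^ K * taylor_remainder b (Suc k) K x)"
      using x Suc.prems by (intro mult_left_mono Suc.IH) auto
    ultimately show "\<exists>y. (?D has_real_derivative y) (at x) \<and> 0 \<le> y"
      by (intro exI[of _ "\<rho> ^ Suc K * taylor_remainder b (Suc k) K x
          - taylor_remainder b (Suc k) K (\<rho> * x) * \<rho>"] conjI) (assumption, simp only: power_Suc mult_ac diff_ge_0_iff_ge)
  qed (rule Suc.prems(1))
  then show ?case by simp
qed

text \<open>The remainder at \<open>s < S\<close> is at most \<open>(s / S) ^ K * b 0 S\<close> by the scaling lemma, so the series converges on all of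
\<open>[0, S)\<close> and not only on half of it, as the Lagrange form of the remainder would give.\<close>

lemma taylor_sums:
  assumes s: "0 \<le> s" "s < S"
  shows "(\<lambda>j. b j 0 * s ^ j / fact j) sums b 0 s"
proof -
  have S: "0 < S" using s by simp
  define \<rho> where "\<rho> = s / S"
  have \<rho>: "0 \<le> \<rho>" "\<rho> < 1" "\<rho> * S = s" using s by (auto simp: \<rho>_def)
  have upper: "taylor_remainder b 0 K s \<le> \<rho> ^ K * b 0 S" for K
  proof -
    have "taylor_remainder b 0 K (\<rho> * S) \<le> \<rho> ^ K * taylor_remainder b 0 K S"
      using \<rho> S by (intro taylor_remainder_scale) auto
    also have "\<dots> \<le> \<rho> ^ K * b 0 S"
      using \<rho> S unfolding taylor_remainder_def
      by (intro mult_left_mono) (auto intro!: sum_nonneg divide_nonneg_nonneg mult_nonneg_nonneg nonneg)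
    finally show ?thesis by (simp add: \<rho>)
  qed
  have lim: "(\<lambda>K. \<rho> ^ K * b 0 S) \<longlonglongrightarrow> 0"
    using \<rho> by (intro tendsto_mult_left_zero LIMSEQ_realpow_zero)
  have "(\<lambda>K. taylor_remainder b 0 K s) \<longlonglongrightarrow> 0"
    by (rule tendsto_sandwich[OF _ _ tendsto_const lim])
       (use s upper taylor_remainder_nonneg[of s 0] in simp_all)
  then have "(\<lambda>K. b 0 s - taylor_remainder b 0 K s) \<longlonglongrightarrow> b 0 s - 0"
    by (intro tendsto_intros)
  then show ?thesis
    by (simp add: sums_def taylor_remainder_def)
qed

end

lemma completely_monotone_has_derivative:
  "completely_monotone g \<Longrightarrow> 0 < t \<Longrightarrow> ((deriv ^^ k) g has_real_derivative (deriv ^^ Suc k) g t) (at t)"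
  by (simp add: completely_monotone_def DERIV_deriv_iff_real_differentiable)

lemma completely_monotone_nonneg: "completely_monotone g \<Longrightarrow> 0 < t \<Longrightarrow> 0 \<le> g t"
  unfolding completely_monotone_def by (drule spec[of _ 0]) simp

lemma completely_monotone_antimono:
  assumes "completely_monotone g" "0 < s" "s \<le> t"
  shows "g t \<le> g s"
proof (rule DERIV_nonpos_imp_nonincreasing[OF assms(3)])
  fix x assume "s \<le> x" "x \<le> t"
  then show "\<exists>y. (g has_real_derivative y) (at x) \<and> y \<le> 0"
    using completely_monotone_has_derivative[OF assms(1), of x 0] assms
    unfolding completely_monotone_def by (intro exI[of _ "deriv g x"]) (auto dest!: spec[of _ "1 :: nat"])
qed

lemma completely_monotone_isCont: "completely_monotone g \<Longrightarrow> 0 < t \<Longrightarrow> isCont g t"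
  using completely_monotone_has_derivative[of g t 0] by (auto intro: DERIV_isCont)

text \<open>The functions \<open>s \<mapsto> (- 1) ^ k * g\<^sup>(\<^sup>k\<^sup>) (c - s)\<close> are nonnegative and each is the derivative of the previous one.\<close>

lemma completely_monotone_expansion:
  assumes g: "completely_monotone g" and s: "0 \<le> s" "s < c"
  shows "(\<lambda>j. (- 1) ^ j * (deriv ^^ j) g c / fact j * s ^ j) sums g (c - s)"
proof -
  define b where "b k s = (- 1) ^ k * (deriv ^^ k) g (c - s)" for k s
  obtain S where S: "s < S" "S < c" using s dense by blast
  have "(\<lambda>j. b j 0 * s ^ j / fact j) sums b 0 s"
  proof (rule taylor_sums)
    fix k x assume "0 \<le> x" "x \<le> S"
    then have x: "0 < c - x" using S by simp
    have "((\<lambda>s. (deriv ^^ k) g (c - s)) has_real_derivative (deriv ^^ Suc k) g (c - x) * (- 1)) (at x)"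
      by (rule DERIV_chain2[where f = "(deriv ^^ k) g" and g = "\<lambda>s. c - s",
            OF completely_monotone_has_derivative[OF g x, of k]])
         (auto intro!: derivative_eq_intros)
    from DERIV_cmult[OF this, of "(- 1) ^ k"]
    show "(b k has_real_derivative b (Suc k) x) (at x)"
      by (simp add: b_def[abs_def])
    show "0 \<le> b k x"
      using g x by (auto simp: b_def completely_monotone_def)
  qed (use s S in auto)
  then show ?thesis
    by (simp add: b_def[abs_def])
qed

lemma completely_monotone_borel:
  assumes "completely_monotone g"
  shows "(\<lambda>t. indicator {0<..} t * g t) \<in> borel_measurable borel"
proof -
  have "continuous_on {0<..} g"
    using completely_monotone_isCont[OF assms]
    by (intro continuous_at_imp_continuous_on) auto
  from borel_measurable_continuous_on_indicator[OF _ this] show ?thesis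
    by simp
qed

text \<open>The expansion about \<open>\<epsilon> + n\<close> at distance \<open>n * exp (- \<tau> / n)\<close>. As a function of \<open>\<tau>\<close> the terms are nonnegative
multiples of \<open>exp (- j \<tau> / n)\<close>. The shift \<open>\<epsilon> > 0\<close> keeps the distance inside the interval of convergence at
\<open>\<tau> = 0\<close>.\<close>

lemma completely_monotone_expansion_exp:
  assumes g: "completely_monotone g" and pos: "0 < \<epsilon>" "0 < n" "0 \<le> \<tau>"
  shows "(\<lambda>j. (- 1) ^ j * (deriv ^^ j) g (\<epsilon> + n) / fact j * n ^ j * exp (- \<tau> / n) ^ j)
    sums g (\<epsilon> + n * (1 - exp (- \<tau> / n)))"
proof -
  have "n * exp (- \<tau> / n) \<le> n * 1"
    using pos by (intro mult_left_mono) auto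
  then have "n * exp (- \<tau> / n) < \<epsilon> + n"
    using pos by linarith
  then show ?thesis
    using completely_monotone_expansion[OF g, of "n * exp (- \<tau> / n)" "\<epsilon> + n"] pos
    by (simp add: algebra_simps power_mult_distrib)
qed

section \<open>Weighted Gaussian mixtures\<close>

lemma radially_decreasing_mult:
  fixes p q :: "'a::euclidean_space \<Rightarrow> real"
  assumes "radially_decreasing p" "radially_decreasing q"
    and "\<And>x. x \<noteq> 0 \<Longrightarrow> 0 \<le> p x" "\<And>x. x \<noteq> 0 \<Longrightarrow> 0 \<le> q x"
  shows "radially_decreasing (\<lambda>x. p x * q x)"
  unfolding radially_decreasing_def
proof (intro allI impI)
  fix x y :: 'a assume "x \<noteq> 0" "norm x \<le> norm y"
  moreover from this have "y \<noteq> 0" by auto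
  ultimately show "p y * q y \<le> p x * q x"
    using assms by (intro mult_mono radially_decreasingD[of p] radially_decreasingD[of q]) auto
qed

lemma radial_kernel_dominated:
  assumes P: "radial_kernel P" and p: "radially_decreasing p" and [measurable]: "p \<in> borel_measurable borel"
    and bound: "\<And>x. x \<noteq> 0 \<Longrightarrow> 0 \<le> p x \<and> p x \<le> P x"
  shows "radial_kernel p"
proof -
  have int: "integrable lborel (\<lambda>x. p x * w x)"
    if [measurable]: "w \<in> borel_measurable borel" and "integrable lborel (\<lambda>x. P x * w x)" for w :: "'a \<Rightarrow> real"
  proof (rule Bochner_Integration.integrable_bound[OF that(2)])
    show "AE x in lborel. norm (p x * w x) \<le> norm (P x * w x)"
      using AE_lborel_singleton[of 0]
    proof eventually_elim
      fix x :: 'a assume "x \<noteq> 0"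
      then have "\<bar>p x\<bar> \<le> \<bar>P x\<bar>" using bound[of x] by auto
      then show "norm (p x * w x) \<le> norm (P x * w x)" by (simp add: abs_mult mult_right_mono)
    qed
  qed measurable
  have "integrable lborel (\<lambda>x. p x * 1)" "integrable lborel (\<lambda>x. p x * (norm x)\<^sup>2)"
    "integrable lborel (\<lambda>x. p x * (1 / (norm x)\<^sup>2))"
    using P by (intro int; simp add: radial_kernel_def)+
  then show ?thesis
    using p bound by (simp add: radial_kernel_def)
qed

lemma sigma_finite_weighted_product:
  assumes "sigma_finite_measure Q"
  shows "sigma_finite_measure (Q \<Otimes>\<^sub>M density (count_space (UNIV :: nat set)) (\<lambda>j. ennreal (a j)))"
proof -
  interpret Q: sigma_finite_measure Q by fact
  interpret C: sigma_finite_measure "count_space (UNIV :: nat set)"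
    by (rule sigma_finite_measure_count_space)
  interpret A: sigma_finite_measure "density (count_space (UNIV :: nat set)) (\<lambda>j. ennreal (a j))"
    by (subst C.sigma_finite_iff_density_finite) auto
  interpret pair_sigma_finite Q "density (count_space (UNIV :: nat set)) (\<lambda>j. ennreal (a j))" ..
  show ?thesis ..
qed

text \<open>Multiplying exponentials adds rates, so the product of a Gaussian mixture with a discrete mixture of exponentials is the
mixture over the product of the mixing measures. The factor \<open>gauss \<delta> x\<close> shifts all rates by \<open>\<delta>\<close>.\<close>

lemma nn_integral_mixture_product:
  fixes f :: "'a::euclidean_space \<Rightarrow> real"
  assumes [measurable]: "\<kappa> \<in> borel_measurable Q"
    and a: "\<And>j. 0 \<le> a j" and sums: "(\<lambda>j. a j * exp (- \<beta> * (norm x)\<^sup>2) ^ j) sums s"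
    and f: "0 \<le> f x" "ennreal (f x) = (\<integral>\<^sup>+v. ennreal (gauss (\<kappa> v) x) \<partial>Q)"
  shows "ennreal (s * gauss \<delta> x * f x) = (\<integral>\<^sup>+vj. ennreal (gauss (\<kappa> (fst vj) + \<delta> + real (snd vj) * \<beta>) x)
    \<partial>(Q \<Otimes>\<^sub>M density (count_space UNIV) (\<lambda>j. ennreal (a j))))" (is "_ = (\<integral>\<^sup>+vj. _ \<partial>(Q \<Otimes>\<^sub>M ?A))")
proof -
  interpret C: sigma_finite_measure "count_space (UNIV :: nat set)"
    by (rule sigma_finite_measure_count_space)
  interpret A: sigma_finite_measure ?A
    by (subst C.sigma_finite_iff_density_finite) auto
  have s: "0 \<le> s"
    by (rule sums_le[OF _ sums_zero sums]) (simp add: a)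
  have "(\<lambda>vj. ennreal (gauss (\<kappa> (fst vj) + \<delta> + real (snd vj) * \<beta>) x)) \<in> borel_measurable (Q \<Otimes>\<^sub>M ?A)"
    unfolding gauss_def by measurable
  from A.nn_integral_fst[OF this, symmetric]
  have "(\<integral>\<^sup>+vj. ennreal (gauss (\<kappa> (fst vj) + \<delta> + real (snd vj) * \<beta>) x) \<partial>(Q \<Otimes>\<^sub>M ?A))
      = (\<integral>\<^sup>+v. \<integral>\<^sup>+j. ennreal (gauss (\<kappa> v + \<delta> + real j * \<beta>) x) \<partial>?A \<partial>Q)"
    by simp
  also have "\<dots> = (\<integral>\<^sup>+v. ennreal (gauss (\<kappa> v) x) * ennreal (s * gauss \<delta> x) \<partial>Q)"
  proof (rule nn_integral_cong)
    fix v
    have "gauss (\<kappa> v + \<delta> + real j * \<beta>) x = gauss (\<kappa> v) x * gauss \<delta> x * exp (- \<beta> * (norm x)\<^sup>2) ^ j" for j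
      by (simp add: gauss_def exp_add[symmetric] exp_of_nat_mult[symmetric] algebra_simps)
    then have term_eq: "ennreal (a j) * ennreal (gauss (\<kappa> v + \<delta> + real j * \<beta>) x)
        = ennreal (gauss (\<kappa> v) x * gauss \<delta> x * (a j * exp (- \<beta> * (norm x)\<^sup>2) ^ j))" for j
      using a[of j] by (simp only: ennreal_mult'[symmetric] mult_ac)
    have "(\<integral>\<^sup>+j. ennreal (gauss (\<kappa> v + \<delta> + real j * \<beta>) x) \<partial>?A)
        = (\<Sum>j. ennreal (a j) * ennreal (gauss (\<kappa> v + \<delta> + real j * \<beta>) x))"
      by (subst nn_integral_density) (simp_all only: nn_integral_count_space_nat measurable_count_space_eq1 UNIV_I Pi_UNIV space_borel)
    also have "\<dots> = (\<Sum>j. ennreal (gauss (\<kappa> v) x * gauss \<delta> x * (a j * exp (- \<beta> * (norm x)\<^sup>2) ^ j)))"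
      by (simp only: term_eq)
    also have "\<dots> = ennreal (gauss (\<kappa> v) x * gauss \<delta> x * s)"
      by (rule suminf_ennreal_eq[OF _ sums_mult[OF sums]]) (simp add: a)
    also have "\<dots> = ennreal (gauss (\<kappa> v) x) * ennreal (s * gauss \<delta> x)"
      using s by (simp only: ennreal_mult[symmetric] mult_ac gauss_nonneg mult_nonneg_nonneg)
    finally show "(\<integral>\<^sup>+j. ennreal (gauss (\<kappa> v + \<delta> + real j * \<beta>) x) \<partial>?A)
        = ennreal (gauss (\<kappa> v) x) * ennreal (s * gauss \<delta> x)" .
  qed
  also have "\<dots> = (\<integral>\<^sup>+v. ennreal (gauss (\<kappa> v) x) \<partial>Q) * ennreal (s * gauss \<delta> x)"
    by (rule nn_integral_multc) (auto simp: gauss_def)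
  also have "\<dots> = ennreal (s * gauss \<delta> x * f x)"
    unfolding f(2)[symmetric] using s f(1) by (simp only: ennreal_mult[symmetric] mult_ac gauss_nonneg mult_nonneg_nonneg)
  finally show "ennreal (s * gauss \<delta> x * f x) = (\<integral>\<^sup>+vj. ennreal (gauss (\<kappa> (fst vj) + \<delta> + real (snd vj) * \<beta>) x)
    \<partial>(Q \<Otimes>\<^sub>M ?A))" by (rule sym)
qed

lemma borel_measurable_completely_monotone_comp:
  fixes T :: "'a::euclidean_space \<Rightarrow> real"
  assumes g: "completely_monotone g" and [measurable]: "T \<in> borel_measurable borel"
    and T: "\<And>x. 0 < T x"
  shows "(\<lambda>x. g (T x)) \<in> borel_measurable borel"
proof -
  note [measurable] = completely_monotone_borel[OF g]
  have "(\<lambda>x. (\<lambda>t. indicator {0<..} t * g t) (T x)) \<in> borel_measurable borel"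
    by measurable
  then show ?thesis
    using T by simp
qed

lemma gauss_mono: "0 \<le> \<kappa> \<Longrightarrow> norm x \<le> norm y \<Longrightarrow> gauss \<kappa> y \<le> gauss \<kappa> x"
  by (simp add: gauss_def mult_left_mono power_mono)

lemma radially_decreasing_gauss_mixture:
  fixes f :: "'a::euclidean_space \<Rightarrow> real"
  assumes \<kappa>: "\<And>v. 0 < \<kappa> v" and f0: "\<And>x. 0 \<le> f x"
    and mix: "\<And>x. x \<noteq> 0 \<Longrightarrow> ennreal (f x) = (\<integral>\<^sup>+v. ennreal (gauss (\<kappa> v) x) \<partial>Q)"
  shows "radially_decreasing f"
  unfolding radially_decreasing_def
proof (intro allI impI)
  fix x y :: 'a assume xy: "x \<noteq> 0" "norm x \<le> norm y"
  then have "y \<noteq> 0" by auto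
  have "ennreal (f y) \<le> ennreal (f x)"
    unfolding mix[OF xy(1)] mix[OF \<open>y \<noteq> 0\<close>]
    by (intro nn_integral_mono ennreal_leI gauss_mono xy less_imp_le[OF \<kappa>])
  then show "f y \<le> f x"
    using f0 by simp
qed

lemma tendsto_saturating_argument:
  "(\<lambda>n. real (Suc n) * (1 - exp (- \<tau> / real (Suc n)))) \<longlonglongrightarrow> \<tau>"
proof (cases "\<tau> = 0")
  case False
  then show ?thesis by real_asymp
qed simp

text \<open>A probability density up to scale, as a mixture of Gaussian kernels with rates \<open>\<kappa> v\<close>; the weights are part of the measure \<open>Q\<close>.\<close>

locale gauss_mixture =
  fixes Q :: "'v measure" and \<kappa> :: "'v \<Rightarrow> real" and f :: "'a::euclidean_space \<Rightarrow> real"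
  assumes dim: "3 \<le> DIM('a)"
    and sigma_finite: "sigma_finite_measure Q" and rate_measurable: "\<kappa> \<in> borel_measurable Q"
    and rate_pos: "\<And>v. 0 < \<kappa> v"
    and density_measurable [measurable]: "f \<in> borel_measurable borel"
    and density_nonneg: "\<And>x. 0 \<le> f x"
    and density_integrable: "integrable lborel f"
    and mixture: "\<And>x. x \<noteq> 0 \<Longrightarrow> ennreal (f x) = (\<integral>\<^sup>+v. ennreal (gauss (\<kappa> v) x) \<partial>Q)"
begin

lemma density_radially_decreasing: "radially_decreasing f"
  by (rule radially_decreasing_gauss_mixture[OF rate_pos density_nonneg mixture])

context
  fixes g :: "real \<Rightarrow> real" and \<alpha> :: real
  assumes cm: "completely_monotone g" and g_pos: "\<And>t. 0 < t \<Longrightarrow> 0 < g t" and \<alpha>: "0 < \<alpha>"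
    and int: "integrable lborel (\<lambda>x. g (\<alpha> * (norm x)\<^sup>2) * f x)"
      "integrable lborel (\<lambda>x. g (\<alpha> * (norm x)\<^sup>2) * f x * (norm x)\<^sup>2)"
      "integrable lborel (\<lambda>x. g (\<alpha> * (norm x)\<^sup>2) * f x / (norm x)\<^sup>2)"
begin

text \<open>\<open>T\<close> stands for the various nondecreasing reparametrisations of the argument of \<open>g\<close> in the approximation.\<close>

lemma radially_decreasing_weighted:
  assumes \<epsilon>: "0 \<le> \<epsilon>" and T: "\<And>s t. 0 < s \<Longrightarrow> s \<le> t \<Longrightarrow> 0 < T s \<and> T s \<le> T t"
  shows "radially_decreasing (\<lambda>x. g (T (\<alpha> * (norm x)\<^sup>2)) * gauss \<epsilon> x * f x)"
proof (intro radially_decreasing_mult density_radially_decreasing)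
  show "radially_decreasing (\<lambda>x :: 'a. g (T (\<alpha> * (norm x)\<^sup>2)))"
    unfolding radially_decreasing_def
  proof (intro allI impI completely_monotone_antimono[OF cm])
    fix x y :: 'a assume "x \<noteq> 0" "norm x \<le> norm y"
    then show "0 < T (\<alpha> * (norm x)\<^sup>2)" "T (\<alpha> * (norm x)\<^sup>2) \<le> T (\<alpha> * (norm y)\<^sup>2)"
      using T[of "\<alpha> * (norm x)\<^sup>2" "\<alpha> * (norm y)\<^sup>2"] \<alpha> by (auto intro!: mult_left_mono power_mono)
  qed
  show "radially_decreasing (gauss \<epsilon> :: 'a \<Rightarrow> real)"
    using \<epsilon> by (auto simp: radially_decreasing_def intro: gauss_mono)
  show "0 \<le> g (T (\<alpha> * (norm x)\<^sup>2))" if "x \<noteq> 0" for x :: 'a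
    using T[of "\<alpha> * (norm x)\<^sup>2" "\<alpha> * (norm x)\<^sup>2"] \<alpha> that completely_monotone_nonneg[OF cm] by auto
  then show "0 \<le> g (T (\<alpha> * (norm x)\<^sup>2)) * gauss \<epsilon> x" if "x \<noteq> 0" for x :: 'a
    using that by simp
qed (auto simp: density_nonneg)

lemma radial_kernel_weighted: "radial_kernel (\<lambda>x. g (\<alpha> * (norm x)\<^sup>2) * f x)"
  using radially_decreasing_weighted[of 0 "\<lambda>t. t"] int \<alpha> density_nonneg
  by (auto simp: radial_kernel_def gauss_def intro!: mult_nonneg_nonneg completely_monotone_nonneg[OF cm])

text \<open>The dominating function for \<open>n \<rightarrow> \<infinity>\<close>. The density itself may lack a second moment and an inverse second
moment: the Gaussian factor provides the former, and near the origin \<open>g (\<alpha> |x|\<^sup>2)\<close> is bounded below by \<open>g \<alpha> > 0\<close>,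
so that the assumed inverse moment of the weighted density provides the latter.\<close>

lemma radial_kernel_damped:
  assumes \<epsilon>: "0 < \<epsilon>"
  shows "radial_kernel (\<lambda>x. g \<epsilon> * gauss \<epsilon> x * f x)"
proof -
  have g\<epsilon>: "0 < g \<epsilon>" using \<epsilon> by (rule g_pos)
  have gauss_le: "gauss \<epsilon> x \<le> 1" for x :: 'a
    using \<epsilon> by (simp add: gauss_def)
  have "integrable lborel (\<lambda>x. gauss \<epsilon> x * f x)"
    by (rule Bochner_Integration.integrable_bound[OF density_integrable])
       (use gauss_le density_nonneg in \<open>auto simp: abs_mult intro!: AE_I2 mult_left_le_one_le\<close>)
  moreover have "integrable lborel (\<lambda>x. gauss \<epsilon> x * f x * (norm x)\<^sup>2)"
  proof (rule Bochner_Integration.integrable_bound)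
    show "integrable lborel (\<lambda>x. 1 / \<epsilon> * f x)"
      by (intro integrable_mult_right density_integrable)
    have "gauss \<epsilon> x * (norm x)\<^sup>2 \<le> 1 / \<epsilon>" for x :: 'a
    proof -
      have "\<epsilon> * (norm x)\<^sup>2 \<le> exp (\<epsilon> * (norm x)\<^sup>2)"
        using exp_ge_add_one_self[of "\<epsilon> * (norm x)\<^sup>2"] by linarith
      then have "gauss \<epsilon> x * (\<epsilon> * (norm x)\<^sup>2) \<le> gauss \<epsilon> x * exp (\<epsilon> * (norm x)\<^sup>2)"
        by (intro mult_left_mono) auto
      also have "\<dots> = 1"
        by (simp add: gauss_def exp_add[symmetric])
      finally show ?thesis using \<epsilon> by (simp add: field_simps)
    qed
    then have "gauss \<epsilon> x * (norm x)\<^sup>2 * f x \<le> 1 / \<epsilon> * f x" for x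
      by (intro mult_right_mono density_nonneg)
    then show "AE x in lborel. norm (gauss \<epsilon> x * f x * (norm x)\<^sup>2) \<le> norm (1 / \<epsilon> * f x)"
      using \<epsilon> density_nonneg by (intro AE_I2) (simp add: abs_mult mult_ac)
  qed measurable
  moreover have inverse: "integrable lborel (\<lambda>x. gauss \<epsilon> x * f x / (norm x)\<^sup>2)"
  proof (rule Bochner_Integration.integrable_bound)
    show "integrable lborel (\<lambda>x. 1 / g \<alpha> * (g (\<alpha> * (norm x)\<^sup>2) * f x / (norm x)\<^sup>2) + f x)"
      by (intro Bochner_Integration.integrable_add integrable_mult_right int density_integrable)
    show "AE x in lborel. norm (gauss \<epsilon> x * f x / (norm x)\<^sup>2)
        \<le> norm (1 / g \<alpha> * (g (\<alpha> * (norm x)\<^sup>2) * f x / (norm x)\<^sup>2) + f x)"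
      using AE_lborel_singleton[of 0]
    proof eventually_elim
      fix x :: 'a assume x: "x \<noteq> 0"
      let ?w = "g (\<alpha> * (norm x)\<^sup>2)"
      have w: "0 < ?w" and g\<alpha>: "0 < g \<alpha>"
        using x \<alpha> by (auto intro!: g_pos)
      have "gauss \<epsilon> x * f x / (norm x)\<^sup>2 \<le> f x / (norm x)\<^sup>2"
        using gauss_le density_nonneg by (intro divide_right_mono mult_left_le_one_le) auto
      also have "\<dots> \<le> 1 / g \<alpha> * (?w * f x / (norm x)\<^sup>2) + f x"
      proof (cases "norm x \<le> 1")
        case True
        then have "\<alpha> * (norm x)\<^sup>2 \<le> \<alpha>"
          using \<alpha> by (simp add: power_le_one)
        then have "g \<alpha> \<le> ?w"
          using x \<alpha> by (intro completely_monotone_antimono[OF cm]) auto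
        then have "1 * (f x / (norm x)\<^sup>2) \<le> (?w / g \<alpha>) * (f x / (norm x)\<^sup>2)"
          using g\<alpha> density_nonneg by (intro mult_right_mono) auto
        then show ?thesis
          using density_nonneg[of x] by (simp add: mult_ac)
      next
        case False
        then have "1 \<le> (norm x)\<^sup>2" by simp
        then have "f x / (norm x)\<^sup>2 \<le> f x / 1"
          using density_nonneg by (intro divide_left_mono) auto
        moreover have "0 \<le> 1 / g \<alpha> * (?w * f x / (norm x)\<^sup>2)"
          using w g\<alpha> density_nonneg by simp
        ultimately show ?thesis by simp
      qed
      finally have "gauss \<epsilon> x * f x / (norm x)\<^sup>2 \<le> 1 / g \<alpha> * (?w * f x / (norm x)\<^sup>2) + f x" .
      then show "norm (gauss \<epsilon> x * f x / (norm x)\<^sup>2)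
          \<le> norm (1 / g \<alpha> * (?w * f x / (norm x)\<^sup>2) + f x)"
        using density_nonneg by (simp add: abs_mult)
    qed
  qed measurable
  moreover have "radially_decreasing (\<lambda>x. g \<epsilon> * gauss \<epsilon> x * f x)"
    using radially_decreasing_weighted[of \<epsilon> "\<lambda>_. \<epsilon>"] \<epsilon> by simp
  ultimately show ?thesis
    using g\<epsilon> density_nonneg integrable_mult_right[OF inverse, of "g \<epsilon>"]
    by (simp add: radial_kernel_def mult.assoc)
qed

text \<open>For fixed \<open>\<epsilon>\<close> and \<open>n\<close> the kernel is exactly a Gaussian mixture, with rates \<open>\<kappa> v + \<epsilon> + j * \<alpha> / n\<close>.\<close>

lemma shrinkage_inequality_saturated:
  assumes r: "shrinkage r" and \<epsilon>: "0 < \<epsilon>" and n: "0 < n"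
  shows "shrinkage_inequality r \<theta>
    (\<lambda>x. g (\<epsilon> + n * (1 - exp (- (\<alpha> * (norm x)\<^sup>2) / n))) * gauss \<epsilon> x * f x)" (is "shrinkage_inequality r \<theta> ?q")
proof -
  let ?T = "\<lambda>t. \<epsilon> + n * (1 - exp (- t / n))"
  define a where "a j = (- 1) ^ j * (deriv ^^ j) g (\<epsilon> + n) / fact j * n ^ j" for j
  have a: "0 \<le> a j" for j
    using cm \<epsilon> n by (auto simp: a_def completely_monotone_def)
  have T: "\<epsilon> \<le> ?T s" "?T s \<le> ?T t" if "0 \<le> s" "s \<le> t" for s t
    using n that by (auto simp: divide_right_mono)
  have kernel: "radial_kernel ?q"
  proof (rule radial_kernel_dominated[OF radial_kernel_damped[OF \<epsilon>]])
    show "radially_decreasing ?q"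
      using \<epsilon> T by (intro radially_decreasing_weighted) (auto intro: less_le_trans)
    have "(\<lambda>x :: 'a. g (\<epsilon> + n * (1 - exp (- (\<alpha> * (norm x)\<^sup>2) / n)))) \<in> borel_measurable borel"
      using \<epsilon> T(1)[of "\<alpha> * (norm x)\<^sup>2" "\<alpha> * (norm x)\<^sup>2" for x :: 'a] \<alpha>
      by (intro borel_measurable_completely_monotone_comp[OF cm]) (auto intro: less_le_trans)
    then show "?q \<in> borel_measurable borel"
      by measurable
    fix x :: 'a
    have "\<epsilon> \<le> ?T (\<alpha> * (norm x)\<^sup>2)"
      using \<alpha> by (intro T(1)[of _ "\<alpha> * (norm x)\<^sup>2"]) auto
    then have "0 \<le> g (?T (\<alpha> * (norm x)\<^sup>2))" "g (?T (\<alpha> * (norm x)\<^sup>2)) \<le> g \<epsilon>"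
      using \<epsilon> by (auto intro!: completely_monotone_nonneg[OF cm] completely_monotone_antimono[OF cm])
    then show "0 \<le> ?q x \<and> ?q x \<le> g \<epsilon> * gauss \<epsilon> x * f x"
      using density_nonneg by (auto intro!: mult_right_mono)
  qed
  have sums: "(\<lambda>j. a j * exp (- (\<alpha> / n) * (norm x)\<^sup>2) ^ j) sums g (?T (\<alpha> * (norm x)\<^sup>2))" for x :: 'a
    using completely_monotone_expansion_exp[OF cm \<epsilon> n, of "\<alpha> * (norm x)\<^sup>2"] \<alpha> by (simp add: a_def)
  note rate_measurable[measurable]
  show ?thesis
  proof (rule shrinkage_inequality_gauss_mixture[OF dim r kernel sigma_finite_weighted_product[OF sigma_finite]])
    show "(\<lambda>vj. \<kappa> (fst vj) + \<epsilon> + real (snd vj) * (\<alpha> / n))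
        \<in> borel_measurable (Q \<Otimes>\<^sub>M density (count_space UNIV) (\<lambda>j. ennreal (a j)))"
      by measurable
    show "0 < \<kappa> (fst vj) + \<epsilon> + real (snd vj) * (\<alpha> / n)" for vj
      using rate_pos[of "fst vj"] \<epsilon> \<alpha> n by (intro add_pos_nonneg add_pos_pos) auto
  qed (rule nn_integral_mixture_product[OF rate_measurable a sums density_nonneg mixture])
qed

text \<open>First \<open>n \<rightarrow> \<infinity>\<close>, where \<open>n (1 - exp (- t / n)) \<rightarrow> t\<close>, dominated by the damped kernel; then \<open>\<epsilon> \<rightarrow> 0\<close> along
\<open>1 / Suc n\<close>, dominated by the limit itself because \<open>g\<close> decreases.\<close>

lemma shrinkage_inequality_weighted:
  assumes r: "shrinkage r"
  shows "shrinkage_inequality r \<theta> (\<lambda>x. g (\<alpha> * (norm x)\<^sup>2) * f x)"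
proof -
  define q where "q \<epsilon> x = g (\<epsilon> + \<alpha> * (norm x)\<^sup>2) * gauss \<epsilon> x * f x" for \<epsilon> x
  have q_measurable: "q \<epsilon> \<in> borel_measurable borel" if "0 < \<epsilon>" for \<epsilon>
  proof -
    have "(\<lambda>x :: 'a. g (\<epsilon> + \<alpha> * (norm x)\<^sup>2)) \<in> borel_measurable borel"
      using that \<alpha> by (intro borel_measurable_completely_monotone_comp[OF cm]) (auto intro!: add_pos_nonneg)
    then show ?thesis
      unfolding q_def by measurable
  qed
  have saturated: "shrinkage_inequality r \<theta> (q \<epsilon>)" if \<epsilon>: "0 < \<epsilon>" for \<epsilon>
  proof -
    define h where "h n x = g (\<epsilon> + real (Suc n) * (1 - exp (- (\<alpha> * (norm x)\<^sup>2) / real (Suc n)))) * gauss \<epsilon> x * f x"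
      for n and x :: 'a
    have arg: "\<epsilon> \<le> \<epsilon> + real (Suc n) * (1 - exp (- (\<alpha> * (norm x)\<^sup>2) / real (Suc n)))" for n and x :: 'a
      using \<alpha> by simp
    show ?thesis
    proof (rule shrinkage_inequality_limit[OF r radial_kernel_damped[OF \<epsilon>] q_measurable[OF \<epsilon>]])
      show "h n \<in> borel_measurable borel" for n
      proof -
        have "(\<lambda>x :: 'a. g (\<epsilon> + real (Suc n) * (1 - exp (- (\<alpha> * (norm x)\<^sup>2) / real (Suc n)))))
            \<in> borel_measurable borel"
          by (intro borel_measurable_completely_monotone_comp[OF cm] less_le_trans[OF \<epsilon> arg]) measurable
        then show ?thesis
          unfolding h_def by measurable
      qed
      show "0 \<le> h n x \<and> h n x \<le> g \<epsilon> * gauss \<epsilon> x * f x" for n x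
        using arg[of n x] \<epsilon> density_nonneg completely_monotone_nonneg[OF cm less_le_trans[OF \<epsilon> arg[of n x]]]
          completely_monotone_antimono[OF cm \<epsilon> arg[of n x]]
        unfolding h_def by (intro conjI mult_right_mono mult_nonneg_nonneg) auto
      show "(\<lambda>n. h n x) \<longlonglongrightarrow> q \<epsilon> x" for x
        unfolding h_def q_def using \<epsilon> \<alpha>
        by (intro tendsto_mult_right isCont_tendsto_compose[OF completely_monotone_isCont[OF cm]]
            tendsto_add tendsto_const tendsto_saturating_argument add_pos_nonneg) auto
      show "shrinkage_inequality r \<theta> (h n)" for n
        unfolding h_def by (rule shrinkage_inequality_saturated[OF r \<epsilon>]) simp
    qed
  qed
  show ?thesis
  proof (rule shrinkage_inequality_limit[OF r radial_kernel_weighted])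
    show "(\<lambda>x. g (\<alpha> * (norm x)\<^sup>2) * f x) \<in> borel_measurable borel"
      using int(1) by auto
    show "q (1 / real (Suc n)) \<in> borel_measurable borel" for n
      by (rule q_measurable) simp
    show "shrinkage_inequality r \<theta> (q (1 / real (Suc n)))" for n
      by (rule saturated) simp
    fix x :: 'a assume x: "x \<noteq> 0"
    then have pos: "0 < \<alpha> * (norm x)\<^sup>2" using \<alpha> by simp
    show "0 \<le> q (1 / real (Suc n)) x \<and> q (1 / real (Suc n)) x \<le> g (\<alpha> * (norm x)\<^sup>2) * f x" for n
    proof -
      let ?\<epsilon> = "1 / real (Suc n)"
      have "0 \<le> g (?\<epsilon> + \<alpha> * (norm x)\<^sup>2)"
        using pos by (intro completely_monotone_nonneg[OF cm] add_pos_pos) auto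
      moreover have "g (?\<epsilon> + \<alpha> * (norm x)\<^sup>2) \<le> g (\<alpha> * (norm x)\<^sup>2)"
        using pos by (intro completely_monotone_antimono[OF cm]) auto
      moreover have "gauss ?\<epsilon> x \<le> 1"
        by (simp add: gauss_def)
      ultimately have "g (?\<epsilon> + \<alpha> * (norm x)\<^sup>2) * gauss ?\<epsilon> x \<le> g (\<alpha> * (norm x)\<^sup>2) * 1"
        by (intro mult_mono) auto
      then show ?thesis
        using \<open>0 \<le> g (?\<epsilon> + \<alpha> * (norm x)\<^sup>2)\<close> density_nonneg[of x] unfolding q_def
        by (intro conjI mult_nonneg_nonneg mult_right_mono) auto
    qed
    have eps: "(\<lambda>n. 1 / real (Suc n)) \<longlonglongrightarrow> 0"
      by (rule LIMSEQ_Suc[OF lim_1_over_n])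
    have "(\<lambda>n. q (1 / real (Suc n)) x) \<longlonglongrightarrow> g (0 + \<alpha> * (norm x)\<^sup>2) * exp (- 0 * (norm x)\<^sup>2) * f x"
      unfolding q_def gauss_def using pos
      by (intro tendsto_intros isCont_tendsto_compose[OF completely_monotone_isCont[OF cm]] eps) auto
    then show "(\<lambda>n. q (1 / real (Suc n)) x) \<longlonglongrightarrow> g (\<alpha> * (norm x)\<^sup>2) * f x"
      by simp
  qed
qed

end

end

section \<open>Scale mixtures of normals\<close>

lemma normal_mass:
  assumes "0 < v"
  shows "(2 * pi * v) powr (- real n / 2) * sqrt (pi / (1 / (2 * v))) ^ n = 1"
proof -
  have "pi / (1 / (2 * v)) = 2 * pi * v"
    by simp
  moreover have "sqrt (2 * pi * v) ^ n = (2 * pi * v) powr (real n / 2)"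
    using assms by (simp add: powr_half_sqrt[symmetric] powr_realpow[symmetric] powr_powr)
  ultimately have "sqrt (pi / (1 / (2 * v))) ^ n = (2 * pi * v) powr (real n / 2)"
    by (simp only:)
  then show ?thesis
    unfolding powr_add[symmetric] using assms by (simp add: powr_add[symmetric])
qed

text \<open>The law determines \<open>f (|x - \<theta>|\<^sup>2)\<close> only almost everywhere, so \<open>f\<close> is exchanged for the version \<open>f\<^sub>0\<close> given by the
mixture integral itself. That integral is finite away from the origin, because it decreases in \<open>|x|\<close> and has total
mass \<open>1\<close>; it is positive, because it could vanish at one point only if the mixing measure were null.\<close>

lemma normal_scale_mixture_gauss_mixture:
  fixes f :: "real \<Rightarrow> real"
  assumes dim: "3 \<le> DIM('a::euclidean_space)"
    and f: "(\<lambda>x :: 'a. f ((norm x)\<^sup>2)) \<in> borel_measurable borel"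
    and mixture: "normal_scale_mixture (location_law f :: 'a \<Rightarrow> 'a measure)"
  obtains Q :: "real measure" and \<kappa> and f\<^sub>0 :: "'a::euclidean_space \<Rightarrow> real"
    where "gauss_mixture Q \<kappa> f\<^sub>0"
      and "\<And>x. x \<noteq> 0 \<Longrightarrow> 0 < f\<^sub>0 x"
      and "\<And>\<theta>. AE x in lborel. ennreal (f ((norm (x - \<theta>))\<^sup>2)) = ennreal (f\<^sub>0 (x - \<theta>))"
proof -
  obtain G :: "real measure" where G: "prob_space G" and sets_G [measurable_cong]: "sets G = sets borel"
    and pos: "AE v in G. 0 < v"
    and law: "\<And>\<theta> A. A \<in> sets borel \<Longrightarrow>
      emeasure (location_law f \<theta>) A = (\<integral>\<^sup>+v. emeasure (normal_law (\<theta> :: 'a) v) A \<partial>G)"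
    using mixture unfolding normal_scale_mixture_def by blast
  interpret G: prob_space G by fact
  define W where "W v = (2 * pi * v) powr (- real DIM('a) / 2)" for v
  \<comment> \<open>The value for \<open>v \<le> 0\<close>, a null set, only serves to make every rate positive.\<close>
  define \<kappa> where "\<kappa> v = (if 0 < v then 1 / (2 * v) else 1)" for v :: real
  define Q where "Q = density G (\<lambda>v. ennreal (W v))"
  define F where "F x = (\<integral>\<^sup>+v. ennreal (gauss (\<kappa> v) x) \<partial>Q)" for x :: 'a
  have [measurable]: "W \<in> borel_measurable borel" "\<kappa> \<in> borel_measurable borel"
    unfolding W_def \<kappa>_def by measurable
  have \<kappa>: "0 < \<kappa> v" for v
    by (simp add: \<kappa>_def)
  have Q: "sigma_finite_measure Q"
    unfolding Q_def by (subst G.sigma_finite_iff_density_finite) auto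
  interpret Q: sigma_finite_measure Q by fact
  interpret QL: pair_sigma_finite Q "lborel :: 'a measure" ..
  have sets_Q [measurable_cong]: "sets Q = sets borel"
    by (simp add: Q_def sets_G)
  have F_measurable [measurable]: "F \<in> borel_measurable borel"
  proof -
    have "(\<lambda>z. ennreal (gauss (\<kappa> (snd z)) (fst z :: 'a))) \<in> borel_measurable (borel \<Otimes>\<^sub>M Q)"
      unfolding gauss_def by measurable
    then show ?thesis
      unfolding F_def by (intro Q.borel_measurable_nn_integral) (simp add: case_prod_beta')
  qed
  have law_density: "location_law f \<theta> = density lborel (\<lambda>x. F (x - \<theta>))" for \<theta>
  proof (rule measure_eqI)
    fix A assume "A \<in> sets (location_law f \<theta>)"
    then have A [measurable]: "A \<in> sets borel" by (simp add: location_law_def)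
    have "emeasure (location_law f \<theta>) A = (\<integral>\<^sup>+v. emeasure (normal_law \<theta> v) A \<partial>G)"
      by (rule law[OF A])
    also have "\<dots> = (\<integral>\<^sup>+v. \<integral>\<^sup>+x. ennreal (W v) * (ennreal (gauss (\<kappa> v) (x - \<theta>)) * indicator A x) \<partial>lborel \<partial>G)"
    proof (rule nn_integral_cong_AE, use pos in eventually_elim)
      fix v :: real assume v: "0 < v"
      have "normal_law \<theta> v = density lborel (\<lambda>x. ennreal (W v) * ennreal (gauss (\<kappa> v) (x - \<theta>)))"
        using v by (simp add: normal_law_def W_def \<kappa>_def gauss_def ennreal_mult'[symmetric])
      then show "emeasure (normal_law \<theta> v) A
          = (\<integral>\<^sup>+x. ennreal (W v) * (ennreal (gauss (\<kappa> v) (x - \<theta>)) * indicator A x) \<partial>lborel)"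
        by (simp add: emeasure_density mult.assoc)
    qed
    also have "\<dots> = (\<integral>\<^sup>+v. \<integral>\<^sup>+x. ennreal (gauss (\<kappa> v) (x - \<theta>)) * indicator A x \<partial>lborel \<partial>Q)"
      unfolding Q_def by (subst nn_integral_density) (auto simp: nn_integral_cmult gauss_def)
    also have "\<dots> = (\<integral>\<^sup>+x. \<integral>\<^sup>+v. ennreal (gauss (\<kappa> v) (x - \<theta>)) * indicator A x \<partial>Q \<partial>lborel)"
      by (rule QL.Fubini'[symmetric]) (simp add: gauss_def)
    also have "\<dots> = (\<integral>\<^sup>+x. F (x - \<theta>) * indicator A x \<partial>lborel)"
      unfolding F_def by (intro nn_integral_cong nn_integral_multc) (simp add: gauss_def)
    also have "\<dots> = emeasure (density lborel (\<lambda>x. F (x - \<theta>))) A"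
      by (simp add: emeasure_density)
    finally show "emeasure (location_law f \<theta>) A = emeasure (density lborel (\<lambda>x. F (x - \<theta>))) A" .
  qed (simp add: location_law_def)
  have mass: "(\<integral>\<^sup>+x. F x \<partial>lborel) = 1"
  proof -
    have "(\<integral>\<^sup>+x. F x \<partial>lborel) = (\<integral>\<^sup>+v. \<integral>\<^sup>+x. ennreal (gauss (\<kappa> v) (x :: 'a)) \<partial>lborel \<partial>Q)"
      unfolding F_def by (rule QL.Fubini') (simp add: gauss_def)
    also have "\<dots> = (\<integral>\<^sup>+v. ennreal (W v) * ennreal (sqrt (pi / \<kappa> v) ^ DIM('a)) \<partial>G)"
      unfolding Q_def nn_integral_gauss[OF \<kappa>] by (subst nn_integral_density) auto
    also have "\<dots> = (\<integral>\<^sup>+v. 1 \<partial>G)"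
    proof (rule nn_integral_cong_AE, use pos in eventually_elim)
      fix v :: real assume v: "0 < v"
      have "W v * sqrt (pi / \<kappa> v) ^ DIM('a) = 1"
        using normal_mass[OF v, of "DIM('a)"] v by (simp add: W_def \<kappa>_def)
      then show "ennreal (W v) * ennreal (sqrt (pi / \<kappa> v) ^ DIM('a)) = 1"
        by (simp add: ennreal_mult'[symmetric] W_def)
    qed
    finally show ?thesis
      by (simp add: G.emeasure_space_1)
  qed
  have F_finite: "F x < \<infinity>" if x: "x \<noteq> 0" for x
  proof -
    have "F x * emeasure lborel (ball 0 (norm x) :: 'a set) = (\<integral>\<^sup>+(y::'a). F x * indicator (ball 0 (norm x)) y \<partial>lborel)"
      by (rule nn_integral_cmult_indicator[symmetric]) simp
    also have "\<dots> \<le> (\<integral>\<^sup>+y. F y \<partial>lborel)"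
    proof (rule nn_integral_mono)
      fix y :: 'a
      have "F x \<le> F y" if "norm y \<le> norm x"
        unfolding F_def using that by (intro nn_integral_mono ennreal_leI gauss_mono less_imp_le[OF \<kappa>])
      then show "F x * indicator (ball 0 (norm x)) y \<le> F y"
        by (auto split: split_indicator)
    qed
    finally have "F x * emeasure lborel (ball 0 (norm x) :: 'a set) \<le> 1"
      using mass by simp
    moreover have "emeasure lborel (ball 0 (norm x) :: 'a set) \<noteq> 0"
      using x content_ball_pos[of "norm x" "0 :: 'a"] by (auto simp: measure_def)
    ultimately show ?thesis
      by (cases "F x") (auto simp: ennreal_top_mult top_unique)
  qed
  have F_pos: "0 < F x" for x
  proof (rule ccontr)
    assume "\<not> 0 < F x"
    then have "(\<integral>\<^sup>+v. ennreal (gauss (\<kappa> v) x) \<partial>Q) = 0" by (simp add: F_def)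
    then have "AE v in Q. ennreal (gauss (\<kappa> v) x) = 0"
      by (subst (asm) nn_integral_0_iff_AE) (auto simp: gauss_def)
    then have "AE v in Q. False"
      by eventually_elim (auto simp: gauss_def)
    then have "F y = (\<integral>\<^sup>+v. 0 \<partial>Q)" for y
      unfolding F_def by (intro nn_integral_cong_AE) auto
    then show False using mass by simp
  qed
  define f\<^sub>0 where "f\<^sub>0 x = enn2real (F x)" for x
  have f0: "ennreal (f\<^sub>0 x) = F x" if "x \<noteq> 0" for x
    using F_finite[OF that] by (simp add: f\<^sub>0_def)
  have "gauss_mixture Q \<kappa> f\<^sub>0"
  proof
    show f\<^sub>0_measurable: "f\<^sub>0 \<in> borel_measurable borel"
      unfolding f\<^sub>0_def by measurable
    have "(\<integral>\<^sup>+x. ennreal (f\<^sub>0 x) \<partial>lborel) = (\<integral>\<^sup>+x. F x \<partial>lborel)"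
      using AE_lborel_singleton[of 0] by (intro nn_integral_cong_AE, eventually_elim) (simp add: f0)
    then show "integrable lborel f\<^sub>0"
      using f\<^sub>0_measurable mass by (intro integrableI_nonneg) (auto simp: f\<^sub>0_def)
    show "\<kappa> \<in> borel_measurable Q"
      by measurable
    show "ennreal (f\<^sub>0 x) = (\<integral>\<^sup>+v. ennreal (gauss (\<kappa> v) x) \<partial>Q)" if "x \<noteq> 0" for x
      using f0[OF that] by (simp add: F_def)
  qed (auto simp: dim Q \<kappa> f\<^sub>0_def)
  moreover have "0 < f\<^sub>0 x" if "x \<noteq> 0" for x
    using F_pos[of x] F_finite[OF that] by (simp add: f\<^sub>0_def enn2real_positive_iff)
  moreover have "AE x in lborel. ennreal (f ((norm (x - \<theta>))\<^sup>2)) = ennreal (f\<^sub>0 (x - \<theta>))" for \<theta> :: 'a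
  proof -
    have "AE x in lborel. ennreal (f ((norm (x - \<theta>))\<^sup>2)) = F (x - \<theta>)"
    proof (rule sigma_finite_measure.density_unique[OF lborel.sigma_finite_measure_axioms])
      show "(\<lambda>x. ennreal (f ((norm (x - \<theta>))\<^sup>2))) \<in> borel_measurable lborel"
        using measurable_compose[OF _ f, of "\<lambda>x. x - \<theta>" borel] by simp
      show "density lborel (\<lambda>x. ennreal (f ((norm (x - \<theta>))\<^sup>2))) = density lborel (\<lambda>x. F (x - \<theta>))"
        using law_density[of \<theta>] by (simp add: location_law_def)
    qed measurable
    then show ?thesis
      using AE_shift_nonzero[of \<theta>] by eventually_elim (simp add: f0)
  qed
  ultimately show thesis
    by (rule that)
qed

section \<open>The loss and the dominance theorem\<close>

text \<open>For \<open>C > 0\<close> this is the mean value theorem with the decreasing derivative. At \<open>C = 0\<close>, where \<open>l\<close> may jump, monotonicity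
of \<open>l\<close> bounds \<open>l 0\<close> by the limit from the right.\<close>

lemma concave_tangent_bound:
  fixes l :: "real \<Rightarrow> real"
  assumes mono: "mono_on {0..} l" and diff: "\<And>t. 0 < t \<Longrightarrow> l differentiable (at t)"
    and cm: "completely_monotone (deriv l)" and A: "0 < A" and C: "0 \<le> C"
  shows "l C \<le> l A + (C - A) * deriv l A"
proof -
  have deriv: "(l has_real_derivative deriv l t) (at t)" if "0 < t" for t
    using diff[OF that] by (simp add: DERIV_deriv_iff_real_differentiable)
  have pos: "l C \<le> l A + (C - A) * deriv l A" if C: "0 < C" for C
  proof (rule linorder_cases[of A C])
    assume AC: "A < C"
    obtain z where z: "A < z" "z < C" "l C - l A = (C - A) * deriv l z"
      using MVT2[OF AC, of l "deriv l"] deriv A by force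
    have "(C - A) * deriv l z \<le> (C - A) * deriv l A"
      using z(1,2) A AC by (intro mult_left_mono completely_monotone_antimono[OF cm]) auto
    then show ?thesis using z(3) by linarith
  next
    assume CA: "C < A"
    obtain z where z: "C < z" "z < A" "l A - l C = (A - C) * deriv l z"
      using MVT2[OF CA, of l "deriv l"] deriv C by force
    have "(A - C) * deriv l A \<le> (A - C) * deriv l z"
      using z C CA by (intro mult_left_mono completely_monotone_antimono[OF cm]) auto
    then show ?thesis using z by (simp add: algebra_simps)
  qed simp
  show ?thesis
  proof (cases "C = 0")
    case True
    have "l 0 \<le> l A + (\<epsilon> - A) * deriv l A" if "0 < \<epsilon>" for \<epsilon>
    proof -
      have "l 0 \<le> l \<epsilon>" using that by (intro mono_onD[OF mono]) auto
      then show ?thesis using pos[OF that] by simp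
    qed
    moreover have "((\<lambda>\<epsilon>. l A + (\<epsilon> - A) * deriv l A) \<longlongrightarrow> l A + (0 - A) * deriv l A) (at_right 0)"
      by (intro tendsto_intros)
    ultimately have "l 0 \<le> l A + (0 - A) * deriv l A"
      by (intro tendsto_lowerbound) (auto intro!: eventually_at_right_less[THEN eventually_mono])
    then show ?thesis using True by simp
  qed (use pos C in auto)
qed

lemma shrinkage_of_derivative_signs:
  fixes r :: "real \<Rightarrow> real"
  assumes bounds: "\<And>t. 0 < t \<Longrightarrow> 0 \<le> r t \<and> r t \<le> 1"
    and diff: "\<And>t. 0 < t \<Longrightarrow> r differentiable (at t)"
    and mono: "\<And>t. 0 < t \<Longrightarrow> 0 \<le> deriv r t"
    and ratio: "\<And>t. 0 < t \<Longrightarrow> deriv (\<lambda>s. r s / s) t \<le> 0"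
  shows "shrinkage r"
  unfolding shrinkage_def
proof (intro conjI allI impI)
  show "mono_on {0<..} r"
  proof (rule mono_onI)
    fix s t :: real assume s: "s \<in> {0<..}" and t: "t \<in> {0<..}" and st: "s \<le> t"
    show "r s \<le> r t"
    proof (rule DERIV_nonneg_imp_nondecreasing[OF st])
      fix x assume "s \<le> x"
      then have "0 < x" using s by simp
      then show "\<exists>y. (r has_real_derivative y) (at x) \<and> 0 \<le> y"
        using diff mono by (auto simp: DERIV_deriv_iff_real_differentiable[symmetric])
    qed
  qed
  fix s t :: real assume s: "0 < s" and st: "s \<le> t"
  show "r t / t \<le> r s / s"
  proof (rule DERIV_nonpos_imp_nonincreasing[OF st])
    fix x assume "s \<le> x"
    then have x: "0 < x" using s by simp
    have "(\<lambda>s. r s / s) differentiable (at x)"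
      using x diff[OF x] by (intro differentiable_divide) auto
    then show "\<exists>y. ((\<lambda>s. r s / s) has_real_derivative y) (at x) \<and> y \<le> 0"
      using ratio[OF x] by (auto simp: DERIV_deriv_iff_real_differentiable[symmetric])
  qed
qed (use bounds in auto)

text \<open>The argument of \<open>l\<close> for the Baranchik estimator is that for \<open>x\<close> plus
\<open>a (1 - \<omega>)\<^sup>2 (a u\<^sup>2 |x|\<^sup>2 - 2 u (x \<bullet> (x - \<theta>)))\<close> with \<open>u = shrink r x\<close>, and \<open>u |x|\<^sup>2 \<le> 1\<close>.\<close>

lemma balanced_loss_baranchik_le:
  fixes x \<theta> :: "'a::euclidean_space"
  assumes mono: "mono_on {0..} l" and diff: "\<And>t. 0 < t \<Longrightarrow> l differentiable (at t)"
    and cm: "completely_monotone (deriv l)" and r: "shrinkage r"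
    and \<omega>: "0 \<le> \<omega>" "\<omega> < 1" and a: "0 < a" and x: "x \<noteq> \<theta>"
  shows "balanced_loss \<omega> l \<theta> x (baranchik (a * (1 - \<omega>)) r x)
    \<le> balanced_loss \<omega> l \<theta> x x
      + a * (1 - \<omega>)\<^sup>2 * (deriv l ((1 - \<omega>) * (norm (x - \<theta>))\<^sup>2)
          * (a * shrink r x - 2 * (shrink r x * (x \<bullet> (x - \<theta>)))))"
proof -
  define u where "u = shrink r x"
  define A where "A = (1 - \<omega>) * (norm (x - \<theta>))\<^sup>2"
  define C where "C = \<omega> * (norm (baranchik (a * (1 - \<omega>)) r x - x))\<^sup>2
    + (1 - \<omega>) * (norm (baranchik (a * (1 - \<omega>)) r x - \<theta>))\<^sup>2"
  have A: "0 < A" using \<omega> x by (simp add: A_def)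
  have C: "0 \<le> C" using \<omega> by (simp add: C_def)
  have b: "baranchik (a * (1 - \<omega>)) r x = x - (a * (1 - \<omega>) * u) *\<^sub>R x"
    by (simp add: baranchik_def u_def shrink_def scaleR_diff_left)
  have d1: "(norm (baranchik (a * (1 - \<omega>)) r x - x))\<^sup>2 = (a * (1 - \<omega>) * u)\<^sup>2 * (norm x)\<^sup>2"
    unfolding b by (simp add: power_mult_distrib)
  have d2: "(norm (baranchik (a * (1 - \<omega>)) r x - \<theta>))\<^sup>2
      = (norm (x - \<theta>))\<^sup>2 - 2 * (a * (1 - \<omega>) * u) * (x \<bullet> (x - \<theta>)) + (a * (1 - \<omega>) * u)\<^sup>2 * (norm x)\<^sup>2"
  proof -
    have "(norm (x - c *\<^sub>R x - \<theta>))\<^sup>2 = (norm (x - \<theta>))\<^sup>2 - 2 * c * (x \<bullet> (x - \<theta>)) + c\<^sup>2 * (norm x)\<^sup>2" for c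
      unfolding power2_norm_eq_inner
      by (simp add: inner_diff_left inner_diff_right inner_commute algebra_simps power2_eq_square)
    then show ?thesis unfolding b .
  qed
  have "C - A = a * (1 - \<omega>)\<^sup>2 * (a * (u * ((norm x)\<^sup>2 * u)) - 2 * (u * (x \<bullet> (x - \<theta>))))"
    unfolding C_def A_def d1 d2 by (simp add: algebra_simps power2_eq_square)
  also have "\<dots> \<le> a * (1 - \<omega>)\<^sup>2 * (a * (u * 1) - 2 * (u * (x \<bullet> (x - \<theta>))))"
    using a norm_power2_shrink_le[OF r, of x] shrink_nonneg[OF r, of x]
    by (intro mult_left_mono diff_right_mono) (auto simp: u_def)
  finally have "(C - A) * deriv l A \<le> a * (1 - \<omega>)\<^sup>2 * (a * (u * 1) - 2 * (u * (x \<bullet> (x - \<theta>)))) * deriv l A"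
    by (intro mult_right_mono completely_monotone_nonneg[OF cm A])
  moreover have "l C \<le> l A + (C - A) * deriv l A"
    by (rule concave_tangent_bound[OF mono diff cm A C])
  ultimately show ?thesis
    by (simp add: balanced_loss_def C_def[symmetric] A_def u_def mult_ac)
qed

text \<open>Since \<open>r\<close> increases, \<open>r t > 0\<close> makes \<open>shrink r\<close> positive outside a ball, and the kernel is positive almost everywhere.\<close>

lemma integral_kernel_shrink_pos:
  fixes p :: "'a::euclidean_space \<Rightarrow> real"
  assumes p: "radial_kernel p" and pos: "\<And>x. x \<noteq> 0 \<Longrightarrow> 0 < p x"
    and r: "shrinkage r" and t: "0 < t" "r t \<noteq> 0"
  shows "0 < (\<integral>x. p (x - \<theta>) * shrink r x \<partial>lborel)"
proof -
  have nonneg: "AE x in lborel. 0 \<le> p (x - \<theta>) * shrink r x"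
    using AE_shift_nonzero[of \<theta>]
    by eventually_elim (auto intro!: mult_nonneg_nonneg radial_kernel_nonneg[OF p] shrink_nonneg[OF r])
  have "(\<integral>x. p (x - \<theta>) * shrink r x \<partial>lborel) \<noteq> 0"
  proof
    assume "(\<integral>x. p (x - \<theta>) * shrink r x \<partial>lborel) = 0"
    then have zero: "AE x in lborel. p (x - \<theta>) * shrink r x = 0"
      using integral_nonneg_eq_0_iff_AE[OF integrable_kernel_shrink[OF p r] nonneg] by simp
    obtain i :: 'a where i: "i \<in> Basis" using nonempty_Basis by blast
    define y where "y = (sqrt t + 1) *\<^sub>R i"
    have "AE x in lborel. x \<notin> ball y 1"
      using zero AE_shift_nonzero[of \<theta>]
    proof eventually_elim
      fix x :: 'a assume z: "p (x - \<theta>) * shrink r x = 0" and x: "x \<noteq> 0 \<and> x - \<theta> \<noteq> 0"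
      show "x \<notin> ball y 1"
      proof
        assume "x \<in> ball y 1"
        then have "norm (y - x) < 1" by (simp add: dist_norm)
        moreover have "norm y = sqrt t + 1" using i t by (simp add: y_def)
        ultimately have "sqrt t < norm x"
          using norm_triangle_ineq2[of y x] by linarith
        then have tx: "t \<le> (norm x)\<^sup>2"
          by (metis less_imp_le real_sqrt_le_iff real_sqrt_abs abs_norm_cancel)
        then have "r t \<le> r ((norm x)\<^sup>2)"
          using r t(1) x mono_onD[of "{0<..}" r t "(norm x)\<^sup>2"] by (simp add: shrinkage_def)
        then have "0 < shrink r x"
          using r t x by (auto simp: shrink_def shrinkage_def order_less_le)
        then show False
          using z pos[of "x - \<theta>"] x by auto
      qed
    qed
    then have "emeasure lborel (ball y 1) = 0"
      using AE_iff_null_sets[of "ball y 1" lborel] by (auto simp: null_sets_def)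
    then show False
      using content_ball_pos[of 1 y] by (simp add: measure_def)
  qed
  then show ?thesis
    using integral_nonneg_AE[OF nonneg] by simp
qed

theorem theorem4:
  fixes f l r :: "real \<Rightarrow> real" and \<omega> a :: real
  assumes dim: "3 \<le> DIM('a::euclidean_space)"
    and f_measurable: "(\<lambda>x :: 'a. f ((norm x)\<^sup>2)) \<in> borel_measurable borel"
    and f_nonneg: "\<And>t. 0 < t \<Longrightarrow> 0 \<le> f t"
    and mixture: "normal_scale_mixture (location_law f :: 'a \<Rightarrow> 'a measure)"
    and omega: "0 \<le> \<omega>" "\<omega> < 1"
    and l_nonneg: "\<And>t. 0 \<le> t \<Longrightarrow> 0 \<le> l t"
    and l_mono: "mono_on {0..} l"
    and l_diff: "\<And>t. 0 < t \<Longrightarrow> l differentiable (at t)"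
    and l_deriv_pos: "\<And>t. 0 < t \<Longrightarrow> 0 < deriv l t"
    and l_cm: "completely_monotone (deriv l)"
    and r_bounds: "\<And>t. 0 < t \<Longrightarrow> 0 \<le> r t \<and> r t \<le> 1"
    and r_nonzero: "\<exists>t>0. r t \<noteq> 0"
    and r_diff: "\<And>t. 0 < t \<Longrightarrow> r differentiable (at t)"
    and r_deriv: "\<And>t. 0 < t \<Longrightarrow> 0 \<le> deriv r t"
    and r_ratio_deriv: "\<And>t. 0 < t \<Longrightarrow> deriv (\<lambda>s. r s / s) t \<le> 0"
    and star_prob: "prob_space (star_law f \<omega> l :: 'a measure)"
    and star_moment: "integrable (star_law f \<omega> l) (\<lambda>x :: 'a. (norm x)\<^sup>2)"
    and star_inverse_moment: "integrable (star_law f \<omega> l) (\<lambda>x :: 'a. 1 / (norm x)\<^sup>2)"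
    and a_pos: "0 < a"
    and a_less: "a < 2 / (\<integral>x. 1 / (norm (x :: 'a))\<^sup>2 \<partial>star_law f \<omega> l)"
    and finite_risk_X: "\<And>\<theta> :: 'a. finite_risk f \<omega> l \<theta> (\<lambda>x. x)"
    and finite_risk_baranchik:
      "\<And>\<theta> :: 'a. finite_risk f \<omega> l \<theta> (baranchik (a * (1 - \<omega>)) r)"
  shows "dominates f \<omega> l (baranchik (a * (1 - \<omega>)) r :: 'a \<Rightarrow> 'a) (\<lambda>x. x)"
proof -
  define \<alpha> where "\<alpha> = 1 - \<omega>"
  have \<alpha>: "0 < \<alpha>" using omega by (simp add: \<alpha>_def)
  have r: "shrinkage r"
    by (rule shrinkage_of_derivative_signs[OF r_bounds r_diff r_deriv r_ratio_deriv])
  obtain t where t: "0 < t" "r t \<noteq> 0"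
    using r_nonzero by blast
  obtain Q :: "real measure" and \<kappa> and f\<^sub>0 :: "'a \<Rightarrow> real"
    where gm: "gauss_mixture Q \<kappa> f\<^sub>0" and f\<^sub>0_pos: "\<And>x. x \<noteq> 0 \<Longrightarrow> 0 < f\<^sub>0 x"
      and f_eq: "\<And>\<theta>. AE x in lborel. ennreal (f ((norm (x - \<theta>))\<^sup>2)) = ennreal (f\<^sub>0 (x - \<theta>))"
    using normal_scale_mixture_gauss_mixture[OF dim f_measurable mixture] by blast
  interpret gauss_mixture Q \<kappa> f\<^sub>0 by (rule gm)
  have f_AE: "AE x in lborel. x - \<theta> \<noteq> 0 \<and> f ((norm (x - \<theta>))\<^sup>2) = f\<^sub>0 (x - \<theta>)" for \<theta> :: 'a
    using f_eq[of \<theta>] AE_shift_nonzero[of \<theta>]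
    by eventually_elim (auto simp: f_nonneg density_nonneg)
  define p where "p x = deriv l (\<alpha> * (norm x)\<^sup>2) * f\<^sub>0 x" for x
  have p_pos: "0 < p x" if "x \<noteq> 0" for x
    unfolding p_def using that \<alpha> by (intro mult_pos_pos l_deriv_pos f\<^sub>0_pos) auto
  have star_AE: "AE x in lborel. x \<noteq> 0 \<and> star_kernel f \<omega> l x = p x"
    using f_AE[of 0] by eventually_elim (auto simp: star_kernel_def p_def \<alpha>_def)
  define N where "N = (\<integral>x. star_kernel f \<omega> l (x :: 'a) \<partial>lborel)"
  \<comment> \<open>A probability law cannot be null, so the normalising integral is genuine and the star kernel integrable.\<close>
  have "N \<noteq> 0"
  proof
    assume "N = 0"
    then have "star_law f \<omega> l = density lborel (\<lambda>x :: 'a. 0)"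
      by (simp add: star_law_def N_def)
    then show False
      using prob_space.emeasure_space_1[OF star_prob] by (simp add: emeasure_density)
  qed
  then have int_star: "integrable lborel (star_kernel f \<omega> l :: 'a \<Rightarrow> real)"
    using not_integrable_integral_eq unfolding N_def by blast
  then have [measurable]: "star_kernel f \<omega> l \<in> borel_measurable (borel :: 'a measure)"
    by auto
  have star_nonneg: "AE x in lborel. 0 \<le> star_kernel f \<omega> l (x :: 'a)"
    using star_AE by eventually_elim (metis less_imp_le p_pos)
  then have N: "0 < N"
    using integral_nonneg_AE[OF star_nonneg] \<open>N \<noteq> 0\<close> by (simp add: N_def)
  have p_measurable [measurable]: "p \<in> borel_measurable borel"
  proof -
    note [measurable] = completely_monotone_borel[OF l_cm]
    have "p = (\<lambda>x. if x = 0 then p 0 else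
        (\<lambda>t. indicator {0<..} t * deriv l t) (\<alpha> * (norm x)\<^sup>2) * f\<^sub>0 x)"
      using \<alpha> by (auto simp: p_def fun_eq_iff)
    moreover have "(\<lambda>x. if x = 0 then p 0 else
        (\<lambda>t. indicator {0<..} t * deriv l t) (\<alpha> * (norm x)\<^sup>2) * f\<^sub>0 x) \<in> borel_measurable borel"
      by measurable
    ultimately show ?thesis by simp
  qed
  have star_weighted: "integrable lborel (\<lambda>x. star_kernel f \<omega> l x * w x) \<longleftrightarrow> integrable lborel (\<lambda>x. p x * w x)"
      "(\<integral>x. star_kernel f \<omega> l x * w x \<partial>lborel) = (\<integral>x. p x * w x \<partial>lborel)"
    if [measurable]: "w \<in> borel_measurable borel" for w :: "'a \<Rightarrow> real"
  proof -
    have eq: "AE x in lborel. star_kernel f \<omega> l x * w x = p x * w x"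
      using star_AE by eventually_elim simp
    show "integrable lborel (\<lambda>x. star_kernel f \<omega> l x * w x) \<longleftrightarrow> integrable lborel (\<lambda>x. p x * w x)"
      by (rule integrable_cong_AE[OF _ _ eq]) measurable
    show "(\<integral>x. star_kernel f \<omega> l x * w x \<partial>lborel) = (\<integral>x. p x * w x \<partial>lborel)"
      by (rule integral_cong_AE[OF _ _ eq]) measurable
  qed
  have star_density: "integrable (star_law f \<omega> l) w \<longleftrightarrow> integrable lborel (\<lambda>x. p x * w x)"
      "(\<integral>x. w x \<partial>star_law f \<omega> l) = (\<integral>x. p x * w x \<partial>lborel) / N"
    if [measurable]: "w \<in> borel_measurable borel" for w :: "'a \<Rightarrow> real"
  proof -
    have nonneg: "AE x in lborel. 0 \<le> star_kernel f \<omega> l (x :: 'a) / N"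
      using star_nonneg by eventually_elim (use N in simp)
    have "integrable (star_law f \<omega> l) w \<longleftrightarrow> integrable lborel (\<lambda>x. star_kernel f \<omega> l x * w x / N)"
      unfolding star_law_def N_def[symmetric] using nonneg by (subst integrable_density) auto
    also have "\<dots> \<longleftrightarrow> integrable lborel (\<lambda>x. star_kernel f \<omega> l x * w x)"
      using N integrable_mult_left_iff[of lborel "1 / N" "\<lambda>x. star_kernel f \<omega> l x * w x"] by simp
    finally show "integrable (star_law f \<omega> l) w \<longleftrightarrow> integrable lborel (\<lambda>x. p x * w x)"
      by (simp only: star_weighted(1)[OF that])
    have "(\<integral>x. w x \<partial>star_law f \<omega> l) = (\<integral>x. star_kernel f \<omega> l x * w x / N \<partial>lborel)"
      unfolding star_law_def N_def[symmetric] using nonneg by (subst integral_density) auto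
    also have "\<dots> = (\<integral>x. star_kernel f \<omega> l x * w x \<partial>lborel) / N"
      by (rule integral_divide_zero)
    finally show "(\<integral>x. w x \<partial>star_law f \<omega> l) = (\<integral>x. p x * w x \<partial>lborel) / N"
      by (simp only: star_weighted(2)[OF that])
  qed
  have int: "integrable lborel p" "integrable lborel (\<lambda>x. p x * (norm x)\<^sup>2)"
    "integrable lborel (\<lambda>x. p x / (norm x)\<^sup>2)"
    using int_star star_weighted(1)[of "\<lambda>_. 1"] star_moment star_density(1)[of "\<lambda>x. (norm x)\<^sup>2"]
      star_inverse_moment star_density(1)[of "\<lambda>x. 1 / (norm x)\<^sup>2"] by simp_all
  note weighted = l_cm l_deriv_pos \<alpha> int[unfolded p_def]
  have kernel: "radial_kernel p"
    unfolding p_def by (rule radial_kernel_weighted[OF weighted])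
  define I where "I = (\<integral>x. p x / (norm x)\<^sup>2 \<partial>lborel)"
  have star_inverse: "(\<integral>x. 1 / (norm (x :: 'a))\<^sup>2 \<partial>star_law f \<omega> l) = I / N"
    using star_density(2)[of "\<lambda>x. 1 / (norm x)\<^sup>2"] by (simp add: I_def)
  have "0 \<le> I"
    unfolding I_def using AE_lborel_singleton[of 0]
    by (intro integral_nonneg_AE, eventually_elim) (simp add: less_imp_le p_pos)
  \<comment> \<open>If \<open>I\<close> were \<open>0\<close>, the bound on \<open>a\<close> would read \<open>a < 2 / 0 = 0\<close>.\<close>
  moreover have "I \<noteq> 0"
    using a_pos a_less star_inverse by auto
  ultimately have I: "0 < I" by simp
  have a_less': "a * I < 2 * N"
    using a_less N I by (simp add: star_inverse field_simps)
  have strict: "risk f \<omega> l \<theta> (baranchik (a * (1 - \<omega>)) r) < risk f \<omega> l \<theta> (\<lambda>x. x)" for \<theta> :: 'a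
  proof -
    define K where "K = (\<integral>x. p (x - \<theta>) * shrink r x \<partial>lborel)"
    define S where "S = (\<integral>x. p (x - \<theta>) * (shrink r x * (x \<bullet> (x - \<theta>))) \<partial>lborel)"
    have K: "0 < K"
      unfolding K_def by (rule integral_kernel_shrink_pos[OF kernel p_pos r t])
    have "N = (\<integral>x. p x \<partial>lborel)"
      using star_weighted(2)[of "\<lambda>_. 1"] by (simp add: N_def)
    then have NK: "N * K \<le> I * S"
      using shrinkage_inequality_weighted[OF weighted r, of \<theta>]
      by (simp add: shrinkage_inequality_def I_def K_def S_def p_def)
    have neg: "a * K - 2 * S < 0"
    proof -
      have "I * (a * K) < 2 * (N * K)"
        using mult_strict_right_mono[OF a_less' K] by (simp add: mult_ac)
      also have "\<dots> \<le> 2 * (I * S)"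
        using NK by simp
      finally have "I * (a * K) < I * (2 * S)" by simp
      then show ?thesis
        using I by simp
    qed
    have f_shift_measurable [measurable]: "(\<lambda>x. f ((norm (x - \<theta>))\<^sup>2)) \<in> borel_measurable borel"
      using measurable_compose[OF _ f_measurable, of "\<lambda>x. x - \<theta>" borel] by simp
    have f_nonneg_AE: "AE x in lborel. 0 \<le> f ((norm (x - \<theta>))\<^sup>2)"
      using f_AE[of \<theta>] by eventually_elim (simp add: density_nonneg)
    have loss: "integrable lborel (\<lambda>x. f ((norm (x - \<theta>))\<^sup>2) * balanced_loss \<omega> l \<theta> x (\<delta> x))"
        "risk f \<omega> l \<theta> \<delta> = (\<integral>x. f ((norm (x - \<theta>))\<^sup>2) * balanced_loss \<omega> l \<theta> x (\<delta> x) \<partial>lborel)"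
      if "finite_risk f \<omega> l \<theta> \<delta>" for \<delta>
    proof -
      have fin: "integrable (location_law f \<theta>) (\<lambda>x. balanced_loss \<omega> l \<theta> x (\<delta> x))"
        using that by (simp add: finite_risk_def)
      then have meas: "(\<lambda>x. balanced_loss \<omega> l \<theta> x (\<delta> x)) \<in> borel_measurable lborel"
        using borel_measurable_integrable[OF fin] by (simp add: location_law_def)
      show "integrable lborel (\<lambda>x. f ((norm (x - \<theta>))\<^sup>2) * balanced_loss \<omega> l \<theta> x (\<delta> x))"
        using fin integrable_density[OF meas _ f_nonneg_AE] by (simp add: location_law_def)
      show "risk f \<omega> l \<theta> \<delta> = (\<integral>x. f ((norm (x - \<theta>))\<^sup>2) * balanced_loss \<omega> l \<theta> x (\<delta> x) \<partial>lborel)"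
        using integral_density[OF meas _ f_nonneg_AE] by (simp add: risk_def location_law_def)
    qed
    let ?b = "baranchik (a * (1 - \<omega>)) r"
    let ?gain = "\<lambda>x. a * (1 - \<omega>)\<^sup>2 * (a * (p (x - \<theta>) * shrink r x)
        - 2 * (p (x - \<theta>) * (shrink r x * (x \<bullet> (x - \<theta>)))))"
    have int_gain: "integrable lborel ?gain"
      by (intro integrable_mult_right Bochner_Integration.integrable_diff
          integrable_kernel_shrink[OF kernel r] integrable_kernel_shrink_inner[OF kernel r])
    have "risk f \<omega> l \<theta> ?b \<le> (\<integral>x. f ((norm (x - \<theta>))\<^sup>2) * balanced_loss \<omega> l \<theta> x x + ?gain x \<partial>lborel)"
      unfolding loss(2)[OF finite_risk_baranchik]
    proof (rule integral_mono_AE)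
      show "AE x in lborel. f ((norm (x - \<theta>))\<^sup>2) * balanced_loss \<omega> l \<theta> x (?b x)
          \<le> f ((norm (x - \<theta>))\<^sup>2) * balanced_loss \<omega> l \<theta> x x + ?gain x"
        using f_AE[of \<theta>]
      proof eventually_elim
        fix x assume x: "x - \<theta> \<noteq> 0 \<and> f ((norm (x - \<theta>))\<^sup>2) = f\<^sub>0 (x - \<theta>)"
        have "f\<^sub>0 (x - \<theta>) * balanced_loss \<omega> l \<theta> x (?b x)
          \<le> f\<^sub>0 (x - \<theta>) * (balanced_loss \<omega> l \<theta> x x
              + a * (1 - \<omega>)\<^sup>2 * (deriv l ((1 - \<omega>) * (norm (x - \<theta>))\<^sup>2)
                * (a * shrink r x - 2 * (shrink r x * (x \<bullet> (x - \<theta>))))))"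
          using x by (intro mult_left_mono density_nonneg
              balanced_loss_baranchik_le[OF l_mono l_diff l_cm r omega a_pos]) auto
        also have "\<dots> = f\<^sub>0 (x - \<theta>) * balanced_loss \<omega> l \<theta> x x + ?gain x"
          by (simp add: p_def \<alpha>_def algebra_simps)
        finally show "f ((norm (x - \<theta>))\<^sup>2) * balanced_loss \<omega> l \<theta> x (?b x)
            \<le> f ((norm (x - \<theta>))\<^sup>2) * balanced_loss \<omega> l \<theta> x x + ?gain x"
          using x by simp
      qed
    qed (intro Bochner_Integration.integrable_add loss(1) int_gain finite_risk_X finite_risk_baranchik)+
    also have "\<dots> = risk f \<omega> l \<theta> (\<lambda>x. x) + a * (1 - \<omega>)\<^sup>2 * (a * K - 2 * S)"
    proof -
      have "(\<integral>x. ?gain x \<partial>lborel) = a * (1 - \<omega>)\<^sup>2 * (a * K - 2 * S)"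
        using integrable_kernel_shrink[OF kernel r, of \<theta>] integrable_kernel_shrink_inner[OF kernel r, of \<theta>]
        by (simp add: K_def S_def)
      then show ?thesis
        using Bochner_Integration.integral_add[OF loss(1)[OF finite_risk_X] int_gain]
        by (simp add: loss(2)[OF finite_risk_X])
    qed
    also have "\<dots> < risk f \<omega> l \<theta> (\<lambda>x. x)"
      using neg a_pos omega by (simp add: mult_pos_neg)
    finally show ?thesis .
  qed
  then show ?thesis
    by (auto simp: dominates_def less_imp_le)
qed

end
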